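(* Let $\xi\sim\mathrm{GD}(\lambda)$ with total mass $T_\xi=\xi(\mathbb{U})$. Let $\omega$ be any non-negative measurable function with $\mathbb{E}[\omega(\Delta_1,T_\xi)]=1$, let $(\Delta^\circ,T^\circ)$ have joint law $$\mathbb{P}(\Delta^\circ\in da,\,T^\circ\in dt)=\omega(a,t)\,\mathbb{P}(\Delta_1\in da,\,T_\xi\in dt),$$ and define the random measure $\eta:=\xi\,|\,(\Delta_1=\Delta^\circ,\,T_\xi=T^\circ)$. Let $\overline{\eta}:=\eta/\eta(\mathbb{U})$ be its normalization, and let $Q_{1:\infty}=(Q_1,Q_2,\ldots)$ be the ranked weights of $\overline{\eta}$. Then, conditionally on $T^\circ=t$ for any $t\in(0,1]$, $\overline{\eta}$ is a Poisson-Kingman measure. More precisely, $$\mathcal{L}(Q_{1:\infty}\,|\,T^\circ=t)=\mathrm{PK}(\lambda,P^\circ_t)\qquad\text{where}\qquad P^\circ_t:=\mathcal{L}(\Delta^\circ t\,|\,T^\circ=t).$$ Additionally conditioning on $\Delta^\circ=a$ makes the law independent of the choice of the law of $\Delta^\circ$, and $$\mathcal{L}(Q_{1:\infty}\,|\,T^\circ=t,\Delta^\circ=a)=\mathrm{PK}(\lambda|at)$$ holds for any $t\in(0,1]$.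
   Context: $\lambda$ is a continuous Lévy density on $(0,\infty)$: $\lambda\ge0$, $\int_0^\infty\min(1,s)\lambda(s)\,ds<\infty$, with $\int_0^\infty\lambda(s)\,ds=\infty$. $\Delta_1>\Delta_2>\cdots$ are the ranked jumps of a subordinator with Lévy density $\lambda$ (the ranked points of a Poisson process on $(0,\infty)$ with intensity $\lambda(s)\,ds$). Let $U_1,U_2,\ldots$ be i.i.d. in a space $\mathbb{U}$, independent of $(\Delta_k)$. $\mathrm{GD}(\lambda)$ is the law of $\xi:=\sum_{k\ge1}\frac{\Delta_{k+1}}{\Delta_1}\delta_{U_k}$. The notation $\eta=\xi\,|\,(\Delta_1=\Delta^\circ,T_\xi=T^\circ)$ means that, given $(\Delta^\circ,T^\circ)=(a,t)$, $\eta$ has the conditional law of $\xi$ given $\Delta_1=a,\ T_\xi=t$. Poisson-Kingman laws: with $T_\Delta:=\sum_{k\ge1}\Delta_k$ and normalized ranked jumps $(\Delta_k/T_\Delta)_{k\ge1}$, let $\mathrm{PK}(\lambda|t)$ be the law of $(\Delta_k/T_\Delta)_{k\ge1}$ given $T_\Delta=t$, and for a probability measure $Q$ on $(0,\infty)$ let $\mathrm{PK}(\lambda,Q):=\int\mathrm{PK}(\lambda|t)\,Q(dt)$; a random probability measure $\sum_k Q_k\delta_{U_k}$ with $(Q_k)$ of such a law, independent of $(U_k)$, is a Poisson-Kingman measure. Conditional laws given values of continuous random variables are understood as regular conditional distributions. *)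

theory Defs
  imports "HOL-Probability.Probability"
begin

text \<open>All sequences are indexed from 0: what is usually written \<open>\<Delta>\<^sub>1, \<Delta>\<^sub>2, \<dots>\<close> is
  \<open>\<Delta> 0, \<Delta> 1, \<dots>\<close> here, and likewise for the locations \<open>U\<close> and the weights.\<close>

definition levy_measure :: "(real \<Rightarrow> real) \<Rightarrow> real measure" where
  "levy_measure l = density lborel (\<lambda>s. ennreal (l s) * indicator {0<..} s)"

definition infinite_levy_density :: "(real \<Rightarrow> real) \<Rightarrow> bool" where
  "infinite_levy_density l \<longleftrightarrow>
     continuous_on {0<..} l \<and> (\<forall>s>0. 0 \<le> l s) \<and>
     (\<integral>\<^sup>+ s\<in>{0<..}. ennreal (min 1 s * l s) \<partial>lborel) < \<infinity> \<and>
     (\<integral>\<^sup>+ s\<in>{0<..}. ennreal (l s) \<partial>lborel) = \<infinity>"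

definition point_count :: "(nat \<Rightarrow> 'a \<Rightarrow> real) \<Rightarrow> real set \<Rightarrow> 'a \<Rightarrow> ennreal" where
  "point_count X A x = emeasure (count_space UNIV) {k. X k x \<in> A}"

text \<open>The points \<open>\<Delta> k\<close> are the ranked points of a Poisson process on \<open>(0, \<infinity>)\<close> with intensity
  \<open>l s ds\<close>: counts in disjoint sets are independent and the count in a set of finite intensity
  is Poisson distributed.\<close>

definition ranked_poisson_points ::
    "'a measure \<Rightarrow> (real \<Rightarrow> real) \<Rightarrow> (nat \<Rightarrow> 'a \<Rightarrow> real) \<Rightarrow> bool" where
  "ranked_poisson_points M l \<Delta> \<longleftrightarrow>
     (\<forall>k. \<Delta> k \<in> borel_measurable M) \<and>
     (AE x in M. \<forall>k. 0 < \<Delta> k x \<and> \<Delta> (Suc k) x < \<Delta> k x) \<and>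
     (\<forall>A\<in>sets borel. emeasure (levy_measure l) A < \<infinity> \<longrightarrow>
        (\<forall>n::nat. measure M {x \<in> space M. point_count \<Delta> A x = of_nat n} =
           measure (levy_measure l) A ^ n / fact n * exp (- measure (levy_measure l) A))) \<and>
     (\<forall>(A :: nat \<Rightarrow> real set) (n::nat).
        range A \<subseteq> sets borel \<longrightarrow> disjoint_family_on A {..<n} \<longrightarrow>
        prob_space.indep_vars M (\<lambda>_. borel) (\<lambda>i. point_count \<Delta> (A i)) {..<n})"

text \<open>The space of all measures on \<open>N\<close>, with the sigma-algebra generated by the evaluations; it
  is defined like \<^const>\<open>subprob_algebra\<close>, without the bound on the total mass.\<close>

definition measure_algebra :: "'u measure \<Rightarrow> 'u measure measure" where
  "measure_algebra N =
     (SUP A\<in>sets N. vimage_algebra {\<mu>. sets \<mu> = sets N} (\<lambda>\<mu>. emeasure \<mu> A) borel)"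

text \<open>\<open>atomic_measure N w u\<close> is the measure \<open>\<Sum>k. w k \<cdot> \<delta>\<^bsub>u k\<^esub>\<close> on \<open>N\<close>, for nonnegative \<open>w\<close>.\<close>

definition atomic_measure :: "'u measure \<Rightarrow> (nat \<Rightarrow> real) \<Rightarrow> (nat \<Rightarrow> 'u) \<Rightarrow> 'u measure" where
  "atomic_measure N w u =
     measure_of (space N) (sets N) (\<lambda>A. \<Sum>k. ennreal (w k) * indicator A (u k))"

lemma space_atomic_measure [simp]: "space (atomic_measure N w u) = space N"
  and sets_atomic_measure [simp]: "sets (atomic_measure N w u) = sets N"
  by (simp_all add: atomic_measure_def)

lemma emeasure_atomic_measure:
  assumes "A \<in> sets N"
  shows "emeasure (atomic_measure N w u) A = (\<Sum>k. ennreal (w k) * indicator A (u k))"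
proof (rule emeasure_measure_of[OF atomic_measure_def])
  show "sets N \<subseteq> Pow (space N)" by (rule sets.space_closed)
  show "A \<in> sets (atomic_measure N w u)" using assms by simp
  show "positive (sets (atomic_measure N w u)) (\<lambda>A. \<Sum>k. ennreal (w k) * indicator A (u k))"
    by (simp add: positive_def)
  show "countably_additive (sets (atomic_measure N w u))
          (\<lambda>A. \<Sum>k. ennreal (w k) * indicator A (u k))"
  proof (rule countably_additiveI)
    fix B :: "nat \<Rightarrow> 'a set"
    assume "disjoint_family B"
    then have *: "(\<Sum>i. indicator (B i) (u k) :: ennreal) = indicator (\<Union>i. B i) (u k)" for k
      by (rule suminf_indicator)
    have "(\<Sum>i k. ennreal (w k) * indicator (B i) (u k)) =
          (\<integral>\<^sup>+ i. (\<integral>\<^sup>+ k. ennreal (w k) * indicator (B i) (u k) \<partial>count_space UNIV)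
             \<partial>count_space UNIV)"
      by (simp add: nn_integral_count_space_nat)
    also have "\<dots> = (\<integral>\<^sup>+ k. (\<integral>\<^sup>+ i. ennreal (w k) * indicator (B i) (u k) \<partial>count_space UNIV)
             \<partial>count_space UNIV)"
      by (rule pair_sigma_finite.Fubini')
         (auto simp: pair_sigma_finite_def sigma_finite_measure_count_space pair_measure_countable)
    also have "\<dots> = (\<Sum>k. ennreal (w k) * indicator (\<Union>i. B i) (u k))"
      by (simp add: nn_integral_count_space_nat nn_integral_cmult *)
    finally show "(\<Sum>i k. ennreal (w k) * indicator (B i) (u k)) =
          (\<Sum>k. ennreal (w k) * indicator (\<Union>i. B i) (u k))" .
  qed
qed

definition total_mass :: "'u measure \<Rightarrow> real" where
  "total_mass \<mu> = measure \<mu> (space \<mu>)"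

definition normalize_measure :: "'u measure \<Rightarrow> 'u measure" where
  "normalize_measure \<mu> = scale_measure (inverse (emeasure \<mu> (space \<mu>))) \<mu>"

abbreviation seq_space :: "(nat \<Rightarrow> real) measure" where
  "seq_space \<equiv> PiM UNIV (\<lambda>_. borel)"

text \<open>\<open>cond_law_on C M X N Y S K\<close>: the probability kernel \<open>K\<close> is a version of the regular
  conditional distribution of \<open>X\<close> given \<open>Y\<close>, for the values of \<open>Y\<close> in \<open>C\<close>; that is,
  \<open>\<L>(X | Y = y) = K y\<close> for \<open>y \<in> C\<close>.\<close>

definition cond_law_on :: "'y set \<Rightarrow> 'a measure \<Rightarrow> ('a \<Rightarrow> 'x) \<Rightarrow> 'x measure \<Rightarrow>
    ('a \<Rightarrow> 'y) \<Rightarrow> 'y measure \<Rightarrow> ('y \<Rightarrow> 'x measure) \<Rightarrow> bool" where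
  "cond_law_on C M X N Y S K \<longleftrightarrow>
     X \<in> measurable M N \<and> Y \<in> measurable M S \<and> C \<in> sets S \<and>
     K \<in> measurable (restrict_space S C) (prob_algebra N) \<and>
     (\<forall>A\<in>sets N. \<forall>B\<in>sets S. B \<subseteq> C \<longrightarrow>
        emeasure M {x \<in> space M. X x \<in> A \<and> Y x \<in> B} =
        (\<integral>\<^sup>+ x. emeasure (K (Y x)) A * indicator B (Y x) \<partial>M))"

abbreviation cond_law :: "'a measure \<Rightarrow> ('a \<Rightarrow> 'x) \<Rightarrow> 'x measure \<Rightarrow>
    ('a \<Rightarrow> 'y) \<Rightarrow> 'y measure \<Rightarrow> ('y \<Rightarrow> 'x measure) \<Rightarrow> bool" where
  "cond_law M X N Y S K \<equiv> cond_law_on (space S) M X N Y S K"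

text \<open>The weights \<open>\<Delta>\<^bsub>k+1\<^esub> / \<Delta>\<^sub>1\<close> and the random measure \<open>\<xi>\<close> whose law is \<open>GD(\<lambda>)\<close>.\<close>

definition gd_weights :: "(nat \<Rightarrow> 'a \<Rightarrow> real) \<Rightarrow> 'a \<Rightarrow> nat \<Rightarrow> real" where
  "gd_weights \<Delta> x = (\<lambda>k. \<Delta> (Suc k) x / \<Delta> 0 x)"

definition gd_measure ::
    "'u measure \<Rightarrow> (nat \<Rightarrow> 'a \<Rightarrow> real) \<Rightarrow> (nat \<Rightarrow> 'a \<Rightarrow> 'u) \<Rightarrow> 'a \<Rightarrow> 'u measure" where
  "gd_measure N \<Delta> U x = atomic_measure N (gd_weights \<Delta> x) (\<lambda>k. U k x)"

text \<open>\<open>PK\<close> is a version of the family \<open>t \<mapsto> PK(\<lambda>|t)\<close>, where \<open>\<Delta>\<close> are the ranked jumps of a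
  subordinator with Levy density \<open>\<lambda>\<close>. It is determined up to null sets of the law of the
  sum of the jumps; its values at \<open>t \<le> 0\<close> are irrelevant.\<close>

definition pk_kernel :: "'a measure \<Rightarrow> (nat \<Rightarrow> 'a \<Rightarrow> real) \<Rightarrow> (real \<Rightarrow> (nat \<Rightarrow> real) measure) \<Rightarrow> bool"
  where "pk_kernel M \<Delta> PK \<longleftrightarrow>
     cond_law M (\<lambda>x k. \<Delta> k x / (\<Sum>j. \<Delta> j x)) seq_space (\<lambda>x. \<Sum>j. \<Delta> j x) borel PK"

definition pk_mixture ::
    "(real \<Rightarrow> (nat \<Rightarrow> real) measure) \<Rightarrow> real measure \<Rightarrow> (nat \<Rightarrow> real) measure" where
  "pk_mixture PK Q = Q \<bind> PK"

text \<open>The law of \<open>\<Sum>k. q k \<cdot> \<delta>\<^bsub>u k\<^esub>\<close> for \<open>q\<close> of law \<open>\<rho>\<close> and, independently, \<open>u\<close> i.i.d. of law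
  \<open>\<nu>\<close>; for \<open>\<rho> = PK(\<lambda>,Q)\<close> this is the law of a Poisson-Kingman measure.\<close>

definition random_weights_law ::
    "'u measure \<Rightarrow> 'u measure \<Rightarrow> (nat \<Rightarrow> real) measure \<Rightarrow> 'u measure measure" where
  "random_weights_law N \<nu> \<rho> =
     distr (\<rho> \<Otimes>\<^sub>M PiM UNIV (\<lambda>_::nat. \<nu>)) (measure_algebra N) (\<lambda>(q, u). atomic_measure N q u)"

end

theory Submission
  imports Defs
begin

text \<open>Conditionally on \<open>\<Delta> 0 = a\<close> the remaining jumps are a Poisson process restricted to \<open>(0, a)\<close>.
  On the event that a configuration has total mass at most \<open>a\<close> the restriction is void, because
  every point is then automatically below \<open>a\<close>. Hence, on \<open>T \<le> 1\<close>, the law of the pair formed by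
  \<open>\<Delta> 0\<close> and the remaining jumps is the restriction of the product of the Levy measure and the law
  of all the jumps, and conditioning the remaining jumps to have sum \<open>a t\<close> gives \<open>PK(\<lambda>|a t)\<close>. The
  tilt by \<open>\<omega>\<close> only changes the law of the conditioning variables.\<close>

subsection \<open>Ranked points and their counts\<close>

text \<open>The obstacle is that the configuration is cut at the random level
  \<open>\<Delta> 0\<close>, while the Poisson hypothesis speaks only of counts in fixed sets. A
  deterministic level \<open>b\<close> with \<open>\<Delta> 1 x \<le> b\<close> and
  \<open>b < \<Delta> 0 x\<close> takes its place. At such a level statements on ranks become
  statements on counts: the head lies in \<open>A\<close> and the rest below \<open>b\<close>
  exactly when \<open>A\<close> holds one point and the remainder of the half-line above
  \<open>b\<close> holds none. The Poisson weights of one point and of no point in \<open>A\<close>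
  differ by the factor \<open>measure \<Lambda> A\<close>; this ratio is the origin of the Levy
  measure, of infinite mass, as first factor of the product, and the points below \<open>b\<close>
  are untouched by it. Countably many rational levels then cover almost every configuration. The
  kernels are arbitrary versions of conditional laws, so the argument runs through integrals of test
  functions instead of pointwise identities of kernels. Independent locations are available on
  \<open>M\<close> only, hence the normalized random measure on \<open>M'\<close> is handled by
  moving to \<open>M\<close>, integrating the locations out there, and moving back.\<close>

lemma disjoint_refinement:
  assumes "finite F" "F \<subseteq> sets R"
  shows "\<exists>(E :: nat \<Rightarrow> 'a set) (n :: nat). range E \<subseteq> sets R \<and> disjoint_family_on E {..<n} \<and>
    (\<forall>i<n. E i \<subseteq> \<Union>F) \<and> (\<forall>X\<in>F. \<exists>J\<subseteq>{..<n}. X = (\<Union>j\<in>J. E j))"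
proof -
  \<comment> \<open>The empty subfamily is left out: its cell \<open>At {}\<close> would be
    everything outside \<open>\<Union>F\<close>.\<close>
  define P where "P = Pow F - {{}}"
  define At where "At G = (\<Inter>X\<in>G. X) - \<Union>(F - G)" for G
  have "finite P" using assms by (simp add: P_def)
  then obtain h where h: "bij_betw h {..<card P} P"
    using ex_bij_betw_nat_finite[of P] by (auto simp: atLeast0LessThan)
  define E where "E i = (if i < card P then At (h i) else {})" for i
  have hP: "h i \<in> P" if "i < card P" for i using h that by (auto simp: bij_betw_def)
  have At_sets: "At G \<in> sets R" if "G \<in> P" for G
  proof -
    have "finite G" "G \<noteq> {}" "G \<subseteq> F" using that assms finite_subset by (auto simp: P_def)
    then have "(\<Inter>X\<in>G. X) \<in> sets R" using assms by (intro sets.finite_INT) auto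
    moreover have "\<Union>(F - G) \<in> sets R" using assms by (intro sets.finite_Union) auto
    ultimately show ?thesis by (auto simp: At_def)
  qed
  show ?thesis
  proof (intro exI[of _ E] exI[of _ "card P"] conjI)
    show "range E \<subseteq> sets R" using At_sets hP by (auto simp: E_def)
    show "disjoint_family_on E {..<card P}"
    proof (unfold disjoint_family_on_def, intro ballI impI)
      fix m n assume mn: "m \<in> {..<card P}" "n \<in> {..<card P}" "m \<noteq> n"
      then have "h m \<noteq> h n" using h by (auto simp: bij_betw_def inj_on_def)
      moreover have "h m \<subseteq> F" "h n \<subseteq> F" using hP mn by (auto simp: P_def)
      \<comment> \<open>A point determines the subfamily of members containing it, hence its cell;
        different cells are therefore disjoint.\<close>
      moreover have At: "G = {X\<in>F. x \<in> X}" if "x \<in> At G" "G \<subseteq> F" for x G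
        using that by (auto simp: At_def)
      ultimately have "False" if "x \<in> At (h m)" "x \<in> At (h n)" for x
        using At[of x "h m"] At[of x "h n"] that by argo
      then have "At (h m) \<inter> At (h n) = {}" by auto
      then show "E m \<inter> E n = {}" using mn by (simp add: E_def)
    qed
    show "\<forall>i<card P. E i \<subseteq> \<Union>F"
    proof (intro allI impI)
      fix i assume i: "i < card P"
      then obtain X where "X \<in> h i" "X \<in> F" using hP[OF i] by (auto simp: P_def)
      then show "E i \<subseteq> \<Union>F" using i by (auto simp: E_def At_def)
    qed
    show "\<forall>X\<in>F. \<exists>J\<subseteq>{..<card P}. X = (\<Union>j\<in>J. E j)"
    proof
      fix X assume X: "X \<in> F"
      show "\<exists>J\<subseteq>{..<card P}. X = (\<Union>j\<in>J. E j)"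
      proof (intro exI conjI)
        show "{i. i < card P \<and> X \<in> h i} \<subseteq> {..<card P}" by auto
        show "X = (\<Union>j\<in>{i. i < card P \<and> X \<in> h i}. E j)"
        proof
          show "X \<subseteq> (\<Union>j\<in>{i. i < card P \<and> X \<in> h i}. E j)"
          proof
            fix x assume x: "x \<in> X"
            have "{Y\<in>F. x \<in> Y} \<in> P" using X x by (auto simp: P_def)
            then have "{Y\<in>F. x \<in> Y} \<in> h ` {..<card P}" using h by (simp add: bij_betw_def)
            then obtain i where i: "i < card P" "h i = {Y\<in>F. x \<in> Y}" by auto
            then have "x \<in> E i" by (auto simp: E_def At_def)
            then show "x \<in> (\<Union>j\<in>{i. i < card P \<and> X \<in> h i}. E j)" using i X x by auto
          qed
        qed (auto simp: E_def At_def)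
      qed
    qed
  qed
qed

section \<open>Finite-dimensional lower orthants in the sequence space\<close>

lemma sets_PiM_borel_atMost:
  "sets (PiM UNIV (\<lambda>_::'i. borel :: real measure)) =
     sigma_sets UNIV {{q. \<forall>k\<in>J. q k \<le> s k} | J s. finite J}" (is "_ = sigma_sets UNIV ?E")
proof
  let ?S = "sigma UNIV ?E"
  have S: "sets ?S = sigma_sets UNIV ?E" "space ?S = UNIV" by auto
  have "(\<lambda>q. q k) \<in> borel_measurable ?S" for k :: 'i
    unfolding borel_measurable_iff_le
  proof
    fix a :: real
    have "{q. q k \<le> a} = {q. \<forall>j\<in>{k}. q j \<le> (\<lambda>_. a) j}" by simp
    also have "\<dots> \<in> ?E"
      by (intro CollectI exI[of _ "{k}"] exI[of _ "\<lambda>_. a"]) simp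
    finally show "{w \<in> space ?S. w k \<le> a} \<in> sets ?S" unfolding S by auto
  qed
  then have "(\<lambda>q. q) \<in> measurable ?S (PiM UNIV (\<lambda>_::'i. borel :: real measure))"
    by (intro measurable_PiM_single') (auto simp: S(2))
  then have "A \<in> sets ?S" if "A \<in> sets (PiM UNIV (\<lambda>_::'i. borel :: real measure))" for A
    using measurable_sets[OF _ that, of "\<lambda>q. q" ?S] by simp
  then show "sets (PiM UNIV (\<lambda>_::'i. borel :: real measure)) \<subseteq> sigma_sets UNIV ?E"
    unfolding S by auto
  have "?E \<subseteq> sets (PiM UNIV (\<lambda>_::'i. borel :: real measure))"
  proof safe
    fix J :: "'i set" and s :: "'i \<Rightarrow> real" assume "finite J"
    have "{q \<in> space (PiM UNIV (\<lambda>_::'i. borel :: real measure)). \<forall>k\<in>J. q k \<le> s k} \<in>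
        sets (PiM UNIV (\<lambda>_::'i. borel :: real measure))"
      using \<open>finite J\<close> by measurable
    then show "{q. \<forall>k\<in>J. q k \<le> s k} \<in> sets (PiM UNIV (\<lambda>_::'i. borel :: real measure))"
      by (simp add: space_PiM)
  qed
  then show "sigma_sets UNIV ?E \<subseteq> sets (PiM UNIV (\<lambda>_::'i. borel :: real measure))"
    using sets.sigma_sets_subset[of ?E "PiM UNIV (\<lambda>_::'i. borel :: real measure)"]
    by (simp add: space_PiM)
qed

lemma Int_stable_atMost_cylinders:
  "Int_stable {{q :: 'i \<Rightarrow> real. \<forall>k\<in>J. q k \<le> s k} | J s. finite J}"
proof (rule Int_stableI, safe)
  fix J J' :: "'i set" and s s' :: "'i \<Rightarrow> real" assume "finite J" "finite J'"
  define t where "t k = (if k \<in> J then (if k \<in> J' then min (s k) (s' k) else s k) else s' k)" for k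
  have "{q. \<forall>k\<in>J. q k \<le> s k} \<inter> {q. \<forall>k\<in>J'. q k \<le> s' k} = {q. \<forall>k\<in>J \<union> J'. q k \<le> t k}"
    by (auto simp: t_def)
  then show "\<exists>J'' s''. {q. \<forall>k\<in>J. q k \<le> s k} \<inter> {q. \<forall>k\<in>J'. q k \<le> s' k} =
      {q. \<forall>k\<in>J''. q k \<le> s'' k} \<and> finite J''"
    using \<open>finite J\<close> \<open>finite J'\<close> by blast
qed

text \<open>Orthants are the events that counts can see, since a bound on a ranked point bounds the
  number of points above a threshold. They form a pi-system, and \<open>J = {}\<close> gives the
  whole space, so a single set of finite measure exhausts it.\<close>

lemma measure_eqI_PiM_atMost:
  fixes \<mu> \<nu> :: "('i \<Rightarrow> real) measure"
  assumes "sets \<mu> = sets (PiM UNIV (\<lambda>_. borel))" "sets \<nu> = sets (PiM UNIV (\<lambda>_. borel))"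
    and "emeasure \<mu> UNIV \<noteq> \<infinity>"
    and "\<And>J s. finite J \<Longrightarrow>
      emeasure \<mu> {q. \<forall>k\<in>J. q k \<le> s k} = emeasure \<nu> {q. \<forall>k\<in>J. q k \<le> s k}"
  shows "\<mu> = \<nu>"
proof (rule measure_eqI_generator_eq[OF Int_stable_atMost_cylinders[where 'i='i]])
  show "range (\<lambda>_::nat. UNIV) \<subseteq> {{q :: 'i \<Rightarrow> real. \<forall>k\<in>J. q k \<le> s k} | J s. finite J}"
    by (auto intro!: exI[of _ "{}"])
qed (use assms in \<open>auto simp: sets_PiM_borel_atMost\<close>)

section \<open>Counts of a ranked sequence\<close>

lemma point_count_disjoint_Un:
  assumes "A \<inter> B = {}"
  shows "point_count X (A \<union> B) x = point_count X A x + point_count X B x"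
proof -
  have "{k. X k x \<in> A \<union> B} = {k. X k x \<in> A} \<union> {k. X k x \<in> B}"
    "{k. X k x \<in> A} \<inter> {k. X k x \<in> B} = {}" using assms by auto
  then show ?thesis
    unfolding point_count_def by (simp add: plus_emeasure)
qed

lemma point_count_disjoint_UN:
  assumes "finite J" "disjoint_family_on E J"
  shows "point_count X (\<Union>j\<in>J. E j) x = (\<Sum>j\<in>J. point_count X (E j) x)"
  using assms
proof (induction J)
  case empty
  then show ?case by (simp add: point_count_def)
next
  case (insert j J)
  have "E j \<inter> (\<Union>i\<in>J. E i) = {}"
    using insert.prems insert.hyps by (fastforce simp: disjoint_family_on_def)
  then show ?case
    using insert by (simp add: point_count_disjoint_Un disjoint_family_on_mono[OF subset_insertI])
qed

lemma point_count_eq_suminf: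
  "point_count X A x = (\<Sum>k. indicator A (X k x))"
proof -
  have "point_count X A x = (\<integral>\<^sup>+ k. indicator {k. X k x \<in> A} k \<partial>count_space UNIV)"
    by (simp add: point_count_def)
  also have "\<dots> = (\<Sum>k. indicator A (X k x))"
    by (simp add: nn_integral_count_space_nat indicator_def)
  finally show ?thesis .
qed

lemma measurable_point_count [measurable]:
  assumes [measurable]: "\<And>k. X k \<in> borel_measurable M" "A \<in> sets borel"
  shows "point_count X A \<in> borel_measurable M"
  unfolding point_count_eq_suminf by measurable

text \<open>The bridge between ranks and counts. Indices start at 0, so \<open>X k x \<le> s\<close>
  leaves exactly the \<open>k\<close> points before it free to exceed \<open>s\<close>; this is why
  the bound is \<open>k\<close> and not \<open>k + 1\<close>.\<close>

lemma point_count_le_iff: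
  assumes "\<And>k. X (Suc k) x < X k x"
  shows "point_count X {s<..} x \<le> of_nat k \<longleftrightarrow> X k x \<le> s"
proof -
  have anti: "X j x \<le> X i x" if "i \<le> j" for i j
    using lift_Suc_antimono_le[of "\<lambda>k. X k x" i j] assms that by (simp add: less_imp_le)
  show ?thesis
  proof
    assume *: "X k x \<le> s"
    have "{j. X j x \<in> {s<..}} \<subseteq> {..<k}"
    proof safe
      fix j assume "s < X j x"
      then show "j < k" using * anti[of k j] by (cases "j < k") auto
    qed
    then have "point_count X {s<..} x \<le> emeasure (count_space UNIV) {..<k}"
      unfolding point_count_def by (intro emeasure_mono) auto
    then show "point_count X {s<..} x \<le> of_nat k" by simp
  next
    assume *: "point_count X {s<..} x \<le> of_nat k"
    show "X k x \<le> s"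
    proof (rule ccontr)
      assume "\<not> X k x \<le> s"
      \<comment> \<open>All \<open>k + 1\<close> points up to index \<open>k\<close> exceed
        \<open>s\<close>, one more than the bound permits.\<close>
      then have "{..k} \<subseteq> {j. X j x \<in> {s<..}}" using anti by fastforce
      then have "emeasure (count_space UNIV) {..k} \<le> point_count X {s<..} x"
        unfolding point_count_def by (intro emeasure_mono) auto
      then have "ennreal (real (Suc k)) \<le> ennreal (real k)"
        using order_trans[OF _ *]
        by (simp add: ennreal_of_nat_eq_real_of_nat del: of_nat_Suc)
      then show False by (subst (asm) ennreal_le_iff) (auto simp del: of_nat_Suc)
    qed
  qed
qed

lemma point_count_Suc:
  "point_count X A x = indicator A (X 0 x) + point_count (\<lambda>k. X (Suc k)) A x"
  unfolding point_count_eq_suminf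
  by (subst suminf_offset[where i=1]) (auto simp: add.commute)

section \<open>The Poisson setting and bounds on the Levy measure\<close>

locale ranked_poisson = prob_space M for M :: "'a measure" +
  fixes l :: "real \<Rightarrow> real" and \<Delta> :: "nat \<Rightarrow> 'a \<Rightarrow> real"
  assumes levy: "infinite_levy_density l"
    and points: "ranked_poisson_points M l \<Delta>"
begin

abbreviation "\<Lambda> \<equiv> levy_measure l"
abbreviation "cnt \<equiv> point_count \<Delta>"

lemma measurable_Delta [measurable]: "\<Delta> k \<in> borel_measurable M"
  using points by (simp add: ranked_poisson_points_def)

lemma AE_Delta: "AE x in M. \<forall>k. 0 < \<Delta> k x \<and> \<Delta> (Suc k) x < \<Delta> k x"
  using points by (simp add: ranked_poisson_points_def)

lemma prob_cnt:
  assumes "A \<in> sets borel" "emeasure \<Lambda> A < \<infinity>"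
  shows "prob {x \<in> space M. cnt A x = of_nat n} =
    measure \<Lambda> A ^ n / fact n * exp (- measure \<Lambda> A)"
  using points assms by (simp add: ranked_poisson_points_def)

lemma indep_cnt:
  assumes "range A \<subseteq> sets borel" "disjoint_family_on A {..<n::nat}"
  shows "indep_vars (\<lambda>_. borel) (\<lambda>i. cnt (A i)) {..<n}"
  using points assms unfolding ranked_poisson_points_def by blast

lemma sets_levy [measurable_cong, simp]: "sets \<Lambda> = sets borel"
  by (simp add: levy_measure_def)

lemma space_levy [simp]: "space \<Lambda> = UNIV"
  by (simp add: levy_measure_def)

lemma measurable_l [measurable]: "(\<lambda>s. ennreal (l s) * indicator {0<..} s) \<in> borel_measurable borel"
proof -
  have "(\<lambda>s. if s \<in> {0<..} then l s else 0) \<in> borel_measurable borel"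
    using levy by (intro borel_measurable_continuous_on_if) (auto simp: infinite_levy_density_def)
  then have "(\<lambda>s. ennreal (if s \<in> {0<..} then l s else 0)) \<in> borel_measurable borel" by simp
  also have "(\<lambda>s. ennreal (if s \<in> {0<..} then l s else 0)) =
      (\<lambda>s. ennreal (l s) * indicator {0<..} s)" by (auto simp: fun_eq_iff)
  finally show ?thesis .
qed

lemma emeasure_levy_atMost_0: 
  assumes [measurable]: "A \<in> sets borel" and "A \<subseteq> {..0}"
  shows "emeasure \<Lambda> A = 0"
proof -
  have "emeasure \<Lambda> A = (\<integral>\<^sup>+ s. ennreal (l s) * indicator {0<..} s * indicator A s \<partial>lborel)"
    unfolding levy_measure_def by (rule emeasure_density) auto
  also have "\<dots> = (\<integral>\<^sup>+ s. 0 \<partial>(lborel :: real measure))"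
    using assms(2) by (intro nn_integral_cong) (auto simp: indicator_def)
  finally show ?thesis by simp
qed

lemma nn_integral_levy_min: "(\<integral>\<^sup>+ s. ennreal (min 1 s) \<partial>\<Lambda>) < \<infinity>"
proof -
  have "(\<integral>\<^sup>+ s. ennreal (min 1 s) \<partial>\<Lambda>) =
      (\<integral>\<^sup>+ s. ennreal (l s) * indicator {0<..} s * ennreal (min 1 s) \<partial>lborel)"
    unfolding levy_measure_def by (intro nn_integral_density) auto
  also have "\<dots> = (\<integral>\<^sup>+ s\<in>{0<..}. ennreal (min 1 s * l s) \<partial>lborel)"
    using levy by (intro nn_integral_cong)
      (auto simp: indicator_def infinite_levy_density_def ennreal_mult' mult.commute)
  also have "\<dots> < \<infinity>" using levy by (simp add: infinite_levy_density_def)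
  finally show ?thesis .
qed

text \<open>Markov's inequality for \<open>min 1 s\<close>: it is at least \<open>min 1 b\<close> on
  the half-line above \<open>b\<close>, which gives the constant \<open>1 / min 1 b\<close>.\<close>

lemma emeasure_levy_greaterThan:
  assumes "0 < b" shows "emeasure \<Lambda> {b<..} < \<infinity>"
proof -
  have "emeasure \<Lambda> {b<..} = (\<integral>\<^sup>+ s. indicator {b<..} s \<partial>\<Lambda>)" by simp
  also have "\<dots> \<le> (\<integral>\<^sup>+ s. ennreal (1 / min 1 b) * ennreal (min 1 s) \<partial>\<Lambda>)"
    using assms
    by (intro nn_integral_mono)
      (auto simp: indicator_def ennreal_mult[symmetric] min_def field_simps simp del: ennreal_1
        simp flip: ennreal_1)
  also have "\<dots> = ennreal (1 / min 1 b) * (\<integral>\<^sup>+ s. ennreal (min 1 s) \<partial>\<Lambda>)"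
    by (intro nn_integral_cmult) auto
  also have "\<dots> < \<infinity>" using nn_integral_levy_min by (auto simp: ennreal_mult_less_top)
  finally show ?thesis .
qed

lemma emeasure_levy_subset:
  assumes "0 < b" "A \<subseteq> {b<..}" shows "emeasure \<Lambda> A < \<infinity>"
  using emeasure_mono[OF assms(2), of \<Lambda>] emeasure_levy_greaterThan[OF assms(1)] by simp

text \<open>Independence is given for disjoint sets, but the \<open>S k\<close> will be overlapping
  intervals. They are cut into disjoint cells, so that each \<open>cnt (S k)\<close> is a sum of
  cell counts; the block of all cells is then independent of the block formed by \<open>B\<close>
  and \<open>B'\<close>, and these two are independent of each other.\<close>

lemma prob_cnt_indep:
  fixes m m' :: ennreal
  assumes B[measurable]: "B \<in> sets borel" "B' \<in> sets borel" and "B \<inter> B' = {}" and J: "finite J"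
    and S: "\<And>k::nat. k \<in> J \<Longrightarrow> S k \<in> sets borel" "\<And>k. k \<in> J \<Longrightarrow> S k \<inter> (B \<union> B') = {}"
  shows "prob {x \<in> space M. (cnt B x = m \<and> cnt B' x = m') \<and> (\<forall>k\<in>J. cnt (S k) x \<le> of_nat k)} =
    prob {x \<in> space M. cnt B x = m} * prob {x \<in> space M. cnt B' x = m'} *
      prob {x \<in> space M. \<forall>k\<in>J. cnt (S k) x \<le> of_nat k}"
proof -
  have "finite (S ` J)" "S ` J \<subseteq> sets borel" using J S by auto
  from disjoint_refinement[OF this]
  obtain E :: "nat \<Rightarrow> real set" and n where E: "range E \<subseteq> sets borel" "disjoint_family_on E {..<n}"
    "\<forall>i<n. E i \<subseteq> \<Union>(S ` J)" "\<forall>X\<in>S ` J. \<exists>I\<subseteq>{..<n}. X = (\<Union>j\<in>I. E j)"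
    by (elim exE conjE) (rule that)
  from E(4) have "\<forall>k\<in>J. \<exists>I. I \<subseteq> {..<n} \<and> S k = (\<Union>j\<in>I. E j)" by simp
  from bchoice[OF this] obtain I where I: "\<And>k. k \<in> J \<Longrightarrow> I k \<subseteq> {..<n}" "\<And>k. k \<in> J \<Longrightarrow> S k = (\<Union>j\<in>I k. E j)"
    by (elim exE) auto
  \<comment> \<open>The cells keep the indices below \<open>n\<close>; \<open>B\<close> is put at
    \<open>n\<close> and \<open>B'\<close> at \<open>n + 1\<close>.\<close>
  define E' where "E' i = (if i < n then E i else if i = n then B else B')" for i
  have disj: "E i \<inter> (B \<union> B') = {}" if "i < n" for i
    using E(3) that S(2) by blast
  have "disjoint_family_on E' {..<n + 2}"
  proof (unfold disjoint_family_on_def, intro ballI impI)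
    fix i j assume ij: "i \<in> {..<n + 2}" "j \<in> {..<n + 2}" "i \<noteq> j"
    have "E' i \<inter> E' j = {}" if "i < j" "j < n + 2" for i j
    proof (cases "j < n")
      case True
      then show ?thesis using E(2) that by (simp add: disjoint_family_on_def E'_def)
    next
      case False
      then have "E' j \<subseteq> B \<union> B'" by (simp add: E'_def)
      then show ?thesis
        using disj[of i] \<open>B \<inter> B' = {}\<close> that False by (cases "i < n") (auto simp: E'_def)
    qed
    from this[of i j] this[of j i] ij show "E' i \<inter> E' j = {}"
      by (cases "i < j") (auto simp: Int_commute)
  qed
  moreover have "range E' \<subseteq> sets borel" using E(1) B by (auto simp: E'_def)
  ultimately have ind: "indep_vars (\<lambda>_. borel) (\<lambda>i. cnt (E' i)) {..<n + 2}"
    by (intro indep_cnt)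
  let ?f = "\<lambda>K x. \<lambda>i\<in>K. cnt (E' i) x"
  let ?X = "{f \<in> space (PiM {n, n+1} (\<lambda>_. borel)). f n = m \<and> f (n+1) = m'}"
  let ?Y = "{f \<in> space (PiM {..<n} (\<lambda>_. borel)). \<forall>k\<in>J. (\<Sum>j\<in>I k. f j) \<le> (of_nat k :: ennreal)}"
  have cnt_S: "cnt (S k) x = (\<Sum>j\<in>I k. cnt (E' j) x)" if "k \<in> J" for k x
  proof -
    have "cnt (S k) x = (\<Sum>j\<in>I k. cnt (E j) x)"
      unfolding I(2)[OF that] using I(1)[OF that] E(2)
      by (intro point_count_disjoint_UN) (auto intro: finite_subset disjoint_family_on_mono)
    also have "\<dots> = (\<Sum>j\<in>I k. cnt (E' j) x)"
      using I(1)[OF that] by (intro sum.cong) (auto simp: E'_def)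
    finally show ?thesis .
  qed
  have iv: "indep_var (PiM {n, n+1} (\<lambda>_. borel)) (?f {n, n+1}) (PiM {..<n} (\<lambda>_. borel)) (?f {..<n})"
    by (rule indep_var_restrict[OF ind]) auto
  have "?X \<in> sets (PiM {n, n+1} (\<lambda>_. borel))" by measurable
  moreover have "?Y \<in> sets (PiM {..<n} (\<lambda>_. borel))"
  proof -
    have [measurable]: "(\<lambda>f. \<Sum>j\<in>I k. f j :: ennreal) \<in> borel_measurable (PiM {..<n} (\<lambda>_. borel))"
      if "k \<in> J" for k
      using I(1)[OF that] by (intro borel_measurable_sum) auto
    show ?thesis using J by measurable
  qed
  ultimately have "prob ((\<lambda>x. (?f {n, n+1} x, ?f {..<n} x)) -` (?X \<times> ?Y) \<inter> space M) =
      prob (?f {n, n+1} -` ?X \<inter> space M) * prob (?f {..<n} -` ?Y \<inter> space M)"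
    by (rule indep_varD[OF iv])
  moreover have "?f {n, n+1} -` ?X \<inter> space M = {x \<in> space M. cnt B x = m \<and> cnt B' x = m'}"
    by (auto simp: space_PiM E'_def)
  moreover have "?f {..<n} -` ?Y \<inter> space M = {x \<in> space M. \<forall>k\<in>J. cnt (S k) x \<le> of_nat k}"
  proof -
    have "(\<Sum>j\<in>I k. ?f {..<n} x j) = cnt (S k) x" if "k \<in> J" for k x
      unfolding cnt_S[OF that] using I(1)[OF that] by (intro sum.cong) auto
    then show ?thesis by (auto simp: space_PiM)
  qed
  moreover have "(\<lambda>x. (?f {n, n+1} x, ?f {..<n} x)) -` (?X \<times> ?Y) \<inter> space M =
      (?f {n, n+1} -` ?X \<inter> space M) \<inter> (?f {..<n} -` ?Y \<inter> space M)" by auto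
  moreover have "prob {x \<in> space M. cnt B x = m \<and> cnt B' x = m'} =
      prob {x \<in> space M. cnt B x = m} * prob {x \<in> space M. cnt B' x = m'}"
  proof -
    have "prob (\<Inter>i\<in>{n, n+1}. cnt (E' i) -` (if i = n then {m} else {m'}) \<inter> space M) =
        (\<Prod>i\<in>{n, n+1}. prob (cnt (E' i) -` (if i = n then {m} else {m'}) \<inter> space M))"
      by (rule indep_varsD[OF ind]) auto
    moreover have "(\<Inter>i\<in>{n, n+1}. cnt (E' i) -` (if i = n then {m} else {m'}) \<inter> space M) =
        {x \<in> space M. cnt B x = m \<and> cnt B' x = m'}" by (auto simp: E'_def)
    moreover have "cnt B -` {m} \<inter> space M = {x \<in> space M. cnt B x = m}"
      "cnt B' -` {m'} \<inter> space M = {x \<in> space M. cnt B' x = m'}" by auto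
    ultimately show ?thesis by (simp add: E'_def)
  qed
  moreover have "{x \<in> space M. cnt B x = m \<and> cnt B' x = m'} \<inter>
      {x \<in> space M. \<forall>k\<in>J. cnt (S k) x \<le> of_nat k} =
      {x \<in> space M. (cnt B x = m \<and> cnt B' x = m') \<and> (\<forall>k\<in>J. cnt (S k) x \<le> of_nat k)}" by auto
  ultimately show ?thesis by simp
qed

end

lemma point_count_eq_0: "(\<And>k. X k x \<notin> A) \<Longrightarrow> point_count X A x = 0"
  by (simp add: point_count_def)

lemma point_count_greaterThanAtMost:
  assumes "\<And>k. X (Suc k) x \<le> X k x" "X 0 x \<le> b"
  shows "point_count X {s<..b} x = point_count X {s<..} x"
proof -
  have "X k x \<le> b" for k
    by (induction k) (use assms in \<open>auto intro: order_trans\<close>)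
  then show ?thesis by (simp add: point_count_def)
qed

lemma emeasure_density_indicator:
  assumes [measurable]: "F \<in> sets M" "B \<in> sets M"
  shows "emeasure (density M (indicator F)) B = emeasure M (F \<inter> B)"
proof -
  have "emeasure (density M (indicator F)) B = (\<integral>\<^sup>+ x. indicator F x * indicator B x \<partial>M)"
    by (rule emeasure_density) auto
  also have "\<dots> = (\<integral>\<^sup>+ x. indicator (F \<inter> B) x \<partial>M)" by (simp add: indicator_inter_arith)
  finally show ?thesis by simp
qed

section \<open>Splitting off the largest point at a fixed level\<close>

context ranked_poisson
begin

text \<open>Both events fix the counts above \<open>b\<close> and bound the same counts below
  \<open>b\<close>. They differ only in whether \<open>A\<close> holds one point or none, and the
  Poisson weights at 1 and 0 have ratio \<open>measure \<Lambda> A\<close>.\<close>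

lemma prob_tail_cylinder:
  assumes b: "0 < b" and A[measurable]: "A \<in> sets borel" and Ab: "A \<subseteq> {b<..}" and J: "finite J"
  shows "prob {x \<in> space M. \<Delta> 0 x \<in> A \<and> \<Delta> 1 x \<le> b \<and> (\<forall>k\<in>J. \<Delta> (Suc k) x \<le> s k)} =
    measure \<Lambda> A * prob {x \<in> space M. \<Delta> 0 x \<le> b \<and> (\<forall>k\<in>J. \<Delta> k x \<le> s k)}"
proof -
  define A' where "A' = {b<..} - A"
  \<comment> \<open>Truncation at \<open>b\<close> keeps these sets disjoint from \<open>A\<close>
    and \<open>A'\<close>. For \<open>s k \<le> 0\<close> the intensity of \<open>S k\<close> is
    infinite, which is harmless: only independence is used for it, and its contribution is the
    common factor \<open>?P\<close>.\<close>
  define S where "S k = {s k<..b}" for k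
  have [measurable]: "A' \<in> sets borel" "S k \<in> sets borel" for k by (auto simp: A'_def S_def)
  have AA': "A \<inter> A' = {}" "A \<union> A' = {b<..}" using Ab by (auto simp: A'_def)
  have ae': "AE x in M. ((\<Delta> 0 x \<in> A \<and> \<Delta> 1 x \<le> b \<and> (\<forall>k\<in>J. \<Delta> (Suc k) x \<le> s k)) \<longleftrightarrow>
       ((cnt A x = 1 \<and> cnt A' x = 0) \<and> (\<forall>k\<in>J. cnt (S k) x \<le> of_nat k))) \<and>
     ((\<Delta> 0 x \<le> b \<and> (\<forall>k\<in>J. \<Delta> k x \<le> s k)) \<longleftrightarrow>
       ((cnt A x = 0 \<and> cnt A' x = 0) \<and> (\<forall>k\<in>J. cnt (S k) x \<le> of_nat k)))"
    using AE_Delta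
  proof eventually_elim
    case (elim x)
    then have dec: "\<Delta> (Suc k) x < \<Delta> k x" for k by auto
    have le: "\<Delta> j x \<le> \<Delta> i x" if "i \<le> j" for i j
      using lift_Suc_antimono_le[of "\<lambda>k. \<Delta> k x" i j] dec that by (simp add: less_imp_le)
    have sum: "cnt {b<..} x = cnt A x + cnt A' x"
      unfolding AA'(2)[symmetric] by (rule point_count_disjoint_Un) (rule AA')
    have 0: "cnt {b<..} x \<le> 0 \<longleftrightarrow> \<Delta> 0 x \<le> b"
      using point_count_le_iff[of \<Delta> x b 0] dec by simp
    have 1: "cnt {b<..} x \<le> 1 \<longleftrightarrow> \<Delta> 1 x \<le> b"
      using point_count_le_iff[of \<Delta> x b 1] dec by simp
    have tl: "cnt X x = indicator X (\<Delta> 0 x)" if "X \<subseteq> {b<..}" "\<Delta> 1 x \<le> b" for X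
    proof -
      have "\<Delta> (Suc k) x \<notin> X" for k
        using le[of 1 "Suc k"] that by force
      then show ?thesis
        unfolding point_count_Suc[of \<Delta> X] by (simp add: point_count_eq_0)
    qed
    \<comment> \<open>A head above \<open>b\<close> does not fall into \<open>S k\<close>, so the
      count sees the shifted sequence, and the same bound \<open>k\<close> now concerns
      \<open>\<Delta> (Suc k)\<close>. In \<open>S0\<close> below, with no point above
      \<open>b\<close>, it concerns \<open>\<Delta> k\<close> itself.\<close>
    have S1: "cnt (S k) x \<le> of_nat k \<longleftrightarrow> \<Delta> (Suc k) x \<le> s k" if "\<Delta> 1 x \<le> b" "b < \<Delta> 0 x" for k
    proof -
      have "cnt (S k) x = indicator (S k) (\<Delta> 0 x) + point_count (\<lambda>k. \<Delta> (Suc k)) (S k) x"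
        by (rule point_count_Suc)
      also have "indicator (S k) (\<Delta> 0 x) = (0 :: ennreal)" using that by (simp add: S_def)
      also have "point_count (\<lambda>k. \<Delta> (Suc k)) (S k) x = point_count (\<lambda>k. \<Delta> (Suc k)) {s k<..} x"
        unfolding S_def using that dec
        by (intro point_count_greaterThanAtMost) (auto simp: less_imp_le)
      finally have "cnt (S k) x = point_count (\<lambda>k. \<Delta> (Suc k)) {s k<..} x" by simp
      then show ?thesis using point_count_le_iff[of "\<lambda>k. \<Delta> (Suc k)" x "s k" k] dec by simp
    qed
    have S0: "cnt (S k) x \<le> of_nat k \<longleftrightarrow> \<Delta> k x \<le> s k" if "\<Delta> 0 x \<le> b" for k
      unfolding S_def using that dec point_count_le_iff[of \<Delta> x "s k" k]
      by (subst point_count_greaterThanAtMost) (auto simp: less_imp_le)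
    have A0: "cnt A x = 0 \<and> cnt A' x = 0 \<longleftrightarrow> \<Delta> 0 x \<le> b" using 0 sum by auto
    have A1: "cnt A x = 1 \<and> cnt A' x = 0 \<longleftrightarrow> \<Delta> 0 x \<in> A \<and> \<Delta> 1 x \<le> b"
    proof
      assume *: "cnt A x = 1 \<and> cnt A' x = 0"
      then have "\<Delta> 1 x \<le> b" using sum 1 by simp
      then show "\<Delta> 0 x \<in> A \<and> \<Delta> 1 x \<le> b"
        using tl[OF Ab] * by (auto simp: indicator_def split: if_splits)
    next
      assume "\<Delta> 0 x \<in> A \<and> \<Delta> 1 x \<le> b"
      then show "cnt A x = 1 \<and> cnt A' x = 0"
        using tl[OF Ab] tl[of A'] by (auto simp: A'_def)
    qed
    have "b < \<Delta> 0 x" if "\<Delta> 0 x \<in> A" using that Ab by auto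
    then have "(\<Delta> 0 x \<in> A \<and> \<Delta> 1 x \<le> b) \<and> (\<forall>k\<in>J. \<Delta> (Suc k) x \<le> s k) \<longleftrightarrow>
        (\<Delta> 0 x \<in> A \<and> \<Delta> 1 x \<le> b) \<and> (\<forall>k\<in>J. cnt (S k) x \<le> of_nat k)"
      using S1 by (intro conj_cong refl ball_cong) simp_all
    moreover have "\<Delta> 0 x \<le> b \<and> (\<forall>k\<in>J. \<Delta> k x \<le> s k) \<longleftrightarrow>
        \<Delta> 0 x \<le> b \<and> (\<forall>k\<in>J. cnt (S k) x \<le> of_nat k)"
      using S0 by (intro conj_cong refl ball_cong) simp_all
    ultimately show ?case unfolding A0 A1 by (simp only: conj_assoc simp_thms)
  qed
  note ae = ae'[unfolded AE_conj_iff, THEN conjunct1] ae'[unfolded AE_conj_iff, THEN conjunct2]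
  have SAA': "S k \<inter> (A \<union> A') = {}" for k using AA' by (auto simp: S_def)
  let ?P = "prob {x \<in> space M. \<forall>k\<in>J. cnt (S k) x \<le> of_nat k}"
  have fin: "emeasure \<Lambda> A < \<infinity>" "emeasure \<Lambda> A' < \<infinity>"
    using emeasure_levy_subset[OF b] Ab by (auto simp: A'_def)
  have "prob {x \<in> space M. \<Delta> 0 x \<in> A \<and> \<Delta> 1 x \<le> b \<and> (\<forall>k\<in>J. \<Delta> (Suc k) x \<le> s k)} =
      prob {x \<in> space M. (cnt A x = 1 \<and> cnt A' x = 0) \<and> (\<forall>k\<in>J. cnt (S k) x \<le> of_nat k)}"
    using J by (intro prob_eq_AE[OF ae(1)]) measurable
  also have "\<dots> = prob {x \<in> space M. cnt A x = 1} * prob {x \<in> space M. cnt A' x = 0} * ?P"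
    by (rule prob_cnt_indep) (use AA' SAA' J in auto)
  \<comment> \<open>The Poisson weight at 1 is \<open>measure \<Lambda> A\<close> times the weight
    at 0; the other factors are unchanged.\<close>
  also have "\<dots> = measure \<Lambda> A *
      (prob {x \<in> space M. cnt A x = 0} * prob {x \<in> space M. cnt A' x = 0} * ?P)"
    using prob_cnt[OF A fin(1), of 1] prob_cnt[OF A fin(1), of 0] by simp
  also have "prob {x \<in> space M. cnt A x = 0} * prob {x \<in> space M. cnt A' x = 0} * ?P =
      prob {x \<in> space M. (cnt A x = 0 \<and> cnt A' x = 0) \<and> (\<forall>k\<in>J. cnt (S k) x \<le> of_nat k)}"
    by (rule prob_cnt_indep[symmetric]) (use AA' SAA' J in auto)
  also have "\<dots> = prob {x \<in> space M. \<Delta> 0 x \<le> b \<and> (\<forall>k\<in>J. \<Delta> k x \<le> s k)}"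
    using J by (intro prob_eq_AE[OF ae(2), symmetric]) measurable
  finally show ?thesis .
qed

definition jumps :: "'a \<Rightarrow> nat \<Rightarrow> real" where "jumps x = (\<lambda>k. \<Delta> k x)"
definition tail_jumps :: "'a \<Rightarrow> nat \<Rightarrow> real" where "tail_jumps x = (\<lambda>k. \<Delta> (Suc k) x)"

lemma measurable_jumps [measurable]:
  "jumps \<in> measurable M seq_space" "tail_jumps \<in> measurable M seq_space"
  unfolding jumps_def[abs_def] tail_jumps_def[abs_def]
  by (auto intro!: measurable_PiM_single')

text \<open>As functions of \<open>C\<close> both sides are finite measures, images of
  \<open>M\<close> restricted by an indicator density, and they agree on the orthants.\<close>

lemma emeasure_tail:
  assumes b: "0 < b" and A[measurable]: "A \<in> sets borel" and Ab: "A \<subseteq> {b<..}"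
    and C: "C \<in> sets seq_space"
  shows "emeasure M {x \<in> space M. \<Delta> 0 x \<in> A \<and> \<Delta> 1 x \<le> b \<and> tail_jumps x \<in> C} =
    emeasure \<Lambda> A * emeasure M {x \<in> space M. \<Delta> 0 x \<le> b \<and> jumps x \<in> C}"
proof -
  define F where "F = {x \<in> space M. \<Delta> 0 x \<in> A \<and> \<Delta> 1 x \<le> b}"
  define G where "G = {x \<in> space M. \<Delta> 0 x \<le> b}"
  have [measurable]: "F \<in> sets M" "G \<in> sets M" unfolding F_def G_def by measurable
  define \<mu> where "\<mu> = distr (density M (indicator F)) seq_space tail_jumps"
  define \<nu> where "\<nu> = scale_measure (emeasure \<Lambda> A) (distr (density M (indicator G)) seq_space jumps)"
  have \<mu>: "emeasure \<mu> C = emeasure M {x \<in> space M. \<Delta> 0 x \<in> A \<and> \<Delta> 1 x \<le> b \<and> tail_jumps x \<in> C}"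
    if [measurable]: "C \<in> sets seq_space" for C
  proof -
    have "emeasure \<mu> C = emeasure M (F \<inter> (tail_jumps -` C \<inter> space M))"
      unfolding \<mu>_def by (subst emeasure_distr) (auto simp: emeasure_density_indicator)
    also have "F \<inter> (tail_jumps -` C \<inter> space M) =
        {x \<in> space M. \<Delta> 0 x \<in> A \<and> \<Delta> 1 x \<le> b \<and> tail_jumps x \<in> C}" by (auto simp: F_def)
    finally show ?thesis .
  qed
  have \<nu>: "emeasure \<nu> C = emeasure \<Lambda> A * emeasure M {x \<in> space M. \<Delta> 0 x \<le> b \<and> jumps x \<in> C}"
    if [measurable]: "C \<in> sets seq_space" for C
  proof -
    have "emeasure \<nu> C = emeasure \<Lambda> A * emeasure M (G \<inter> (jumps -` C \<inter> space M))"
      unfolding \<nu>_def emeasure_scale_measure by (subst emeasure_distr) (auto simp: emeasure_density_indicator)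
    also have "G \<inter> (jumps -` C \<inter> space M) = {x \<in> space M. \<Delta> 0 x \<le> b \<and> jumps x \<in> C}"
      by (auto simp: G_def)
    finally show ?thesis .
  qed
  have fin: "emeasure \<Lambda> A = ennreal (measure \<Lambda> A)"
    using emeasure_levy_subset[OF b Ab] by (simp add: emeasure_eq_ennreal_measure)
  have "\<mu> = \<nu>"
  proof (rule measure_eqI_PiM_atMost)
    have UNIV: "UNIV \<in> sets seq_space"
      using sets.top[of seq_space] by (simp add: space_PiM)
    then show "emeasure \<mu> UNIV \<noteq> \<infinity>" by (simp add: \<mu>)
    fix J :: "nat set" and s :: "nat \<Rightarrow> real" assume J: "finite J"
    have C: "{q. \<forall>k\<in>J. q k \<le> s k} \<in> sets seq_space"
      unfolding sets_PiM_borel_atMost using J by blast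
    show "emeasure \<mu> {q. \<forall>k\<in>J. q k \<le> s k} = emeasure \<nu> {q. \<forall>k\<in>J. q k \<le> s k}"
      unfolding \<mu>[OF C] \<nu>[OF C] fin emeasure_eq_measure
      using prob_tail_cylinder[OF b A Ab J, of s]
      by (simp add: jumps_def tail_jumps_def flip: ennreal_mult)
  qed (simp_all add: \<mu>_def \<nu>_def)
  then show ?thesis using \<mu>[OF C] \<nu>[OF C] by simp
qed

end

subsection \<open>The largest jump and Campbell's formula\<close>

text \<open>The factor \<open>n\<close> cancels against the factorial and the term at 0 vanishes,
  which leaves \<open>c\<close> times the exponential series shifted by one.\<close>

lemma poisson_mean_sums: "(\<lambda>n. real n * (c ^ n / fact n * exp (- c))) sums c"
proof -
  have "(\<lambda>n. c * exp (- c) * (c ^ n /\<^sub>R fact n)) sums (c * exp (- c) * exp c)"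
    by (intro sums_mult exp_converges)
  also have "(\<lambda>n. c * exp (- c) * (c ^ n /\<^sub>R fact n)) =
      (\<lambda>n. real (Suc n) * (c ^ Suc n / fact (Suc n) * exp (- c)))"
  proof
    fix n
    have "fact (Suc n) = real (Suc n) * fact n" by simp
    then show "c * exp (- c) * (c ^ n /\<^sub>R fact n) =
        real (Suc n) * (c ^ Suc n / fact (Suc n) * exp (- c))"
      by (simp add: divide_simps del: fact_Suc of_nat_Suc)
  qed
  finally have "(\<lambda>n. real n * (c ^ n / fact n * exp (- c))) sums (c * exp (- c) * exp c + 0)"
    by (subst (asm) sums_Suc_iff) simp
  moreover have "c * exp (- c) * exp c + 0 = c" by (simp add: exp_minus)
  ultimately show ?thesis by (simp only:)
qed

context ranked_poisson
begin

abbreviation "law_jumps \<equiv> distr M seq_space jumps"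

lemma prob_space_law_jumps: "prob_space law_jumps"
  by (rule prob_space_distr) measurable

text \<open>For fixed \<open>b\<close> the constraint is a rectangle, and above \<open>b\<close> the
  Levy measure is finite. The restricted measures are thus finite and can be compared on product
  sets, where \<open>emeasure_tail\<close> applies.\<close>

lemma emeasure_head_tail_piece:
  assumes b: "0 < b" and X[measurable]: "X \<in> sets (borel \<Otimes>\<^sub>M seq_space)"
  shows "emeasure (distr M (borel \<Otimes>\<^sub>M seq_space) (\<lambda>x. (\<Delta> 0 x, tail_jumps x))) (X \<inter> {(a, q). b < a \<and> q 0 \<le> b}) =
    emeasure (\<Lambda> \<Otimes>\<^sub>M law_jumps) (X \<inter> {(a, q). b < a \<and> q 0 \<le> b})"
proof -
  let ?L = "distr M (borel \<Otimes>\<^sub>M seq_space) (\<lambda>x. (\<Delta> 0 x, tail_jumps x))"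
  let ?R = "\<Lambda> \<Otimes>\<^sub>M law_jumps"
  define G where "G = {(a, q :: nat \<Rightarrow> real). b < a \<and> q 0 \<le> b}"
  define H where "H = {q :: nat \<Rightarrow> real. q 0 \<le> b}"
  have sR[simp]: "sets ?R = sets (borel \<Otimes>\<^sub>M seq_space)"
    by (intro sets_pair_measure_cong) simp_all
  have "{q \<in> space seq_space. q 0 \<le> b} \<in> sets seq_space" by measurable
  then have H[measurable]: "H \<in> sets seq_space" by (simp add: H_def space_PiM)
  have GH: "G = {b<..} \<times> H" by (auto simp: G_def H_def)
  have G[measurable]: "G \<in> sets (borel \<Otimes>\<^sub>M seq_space)" unfolding GH by measurable
  let ?P = "density \<Lambda> (indicator {b<..})" and ?Q = "density law_jumps (indicator H)"
  interpret J: prob_space law_jumps by (rule prob_space_law_jumps)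
  have fin: "finite_measure ?P" "finite_measure ?Q"
  proof -
    have "emeasure ?P (space ?P) < \<infinity>"
      using emeasure_density_indicator[of "{b<..}" \<Lambda> UNIV] emeasure_levy_greaterThan[OF b] by simp
    then show "finite_measure ?P" by (intro finite_measureI) auto
    have "emeasure ?Q (space ?Q) < \<infinity>"
      using emeasure_density_indicator[of H law_jumps "space law_jumps"] le_less_trans[OF J.emeasure_le_1[of H], of \<infinity>]
      by simp
    then show "finite_measure ?Q" by (intro finite_measureI) auto
  qed
  then have sf: "sigma_finite_measure ?P" "sigma_finite_measure ?Q"
    by (auto simp: finite_measure_def)
  have "?P \<Otimes>\<^sub>M ?Q = density ?L (indicator G)"
  proof (rule pair_measure_eqI[OF sf])
    show "sets (?P \<Otimes>\<^sub>M ?Q) = sets (density ?L (indicator G))"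
      unfolding sets_density sets_distr by (intro sets_pair_measure_cong) simp_all
    fix A C assume "A \<in> sets ?P" "C \<in> sets ?Q"
    then have A[measurable]: "A \<in> sets borel" and C[measurable]: "C \<in> sets seq_space" by auto
    have "emeasure ?P A * emeasure ?Q C = emeasure \<Lambda> (A \<inter> {b<..}) * emeasure law_jumps (H \<inter> C)"
      by (simp add: emeasure_density_indicator Int_commute)
    also have "emeasure law_jumps (H \<inter> C) = emeasure M {x \<in> space M. \<Delta> 0 x \<le> b \<and> jumps x \<in> C}"
    proof (subst emeasure_distr)
      show "H \<inter> C \<in> sets seq_space" by measurable
    qed (auto simp: H_def jumps_def intro!: arg_cong[where f="emeasure M"])
    also have "emeasure \<Lambda> (A \<inter> {b<..}) * \<dots> =
        emeasure M {x \<in> space M. \<Delta> 0 x \<in> A \<inter> {b<..} \<and> \<Delta> 1 x \<le> b \<and> tail_jumps x \<in> C}"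
      by (intro emeasure_tail[symmetric] b) auto
    also have "\<dots> = emeasure ?L (G \<inter> (A \<times> C))"
    proof (subst emeasure_distr)
      show "G \<inter> (A \<times> C) \<in> sets (borel \<Otimes>\<^sub>M seq_space)" by measurable
      show "(\<lambda>x. (\<Delta> 0 x, tail_jumps x)) \<in> measurable M (borel \<Otimes>\<^sub>M seq_space)" by measurable
    qed (auto simp: GH H_def tail_jumps_def intro!: arg_cong[where f="emeasure M"])
    also have "\<dots> = emeasure (density ?L (indicator G)) (A \<times> C)"
      by (intro emeasure_density_indicator[symmetric]) auto
    finally show "emeasure ?P A * emeasure ?Q C = emeasure (density ?L (indicator G)) (A \<times> C)" .
  qed
  moreover have "?P \<Otimes>\<^sub>M ?Q = density ?R (\<lambda>(a, q). indicator {b<..} a * indicator H q)"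
    by (rule pair_measure_density) (use sf J.sigma_finite_measure_axioms in auto)
  moreover have "(\<lambda>(a, q). indicator {b<..} a * indicator H q) = (indicator G :: _ \<Rightarrow> ennreal)"
    by (auto simp: GH indicator_def fun_eq_iff)
  ultimately have "emeasure (density ?L (indicator G)) X = emeasure (density ?R (indicator G)) X"
    by simp
  then have "emeasure ?L (G \<inter> X) = emeasure ?R (G \<inter> X)"
    by (simp add: emeasure_density_indicator)
  then show ?thesis by (simp add: G_def Int_commute)
qed

text \<open>For \<open>q 0 < a\<close> the configuration \<open>q\<close> together with the additional point \<open>a\<close> has first point
  \<open>a\<close>, so this is the Mecke equation for the largest point.\<close>

lemma distr_head_tail:
  "distr M (borel \<Otimes>\<^sub>M seq_space) (\<lambda>x. (\<Delta> 0 x, tail_jumps x)) =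
     density (\<Lambda> \<Otimes>\<^sub>M law_jumps) (indicator {(a, q). 0 < a \<and> q 0 < a})" (is "?L = density ?R (indicator ?G)")
proof (rule measure_eqI)
  have sR[simp]: "sets ?R = sets (borel \<Otimes>\<^sub>M seq_space)"
    by (intro sets_pair_measure_cong) simp_all
  then show "sets ?L = sets (density ?R (indicator ?G))" by simp
  fix X assume "X \<in> sets ?L"
  then have X[measurable]: "X \<in> sets (borel \<Otimes>\<^sub>M seq_space)" by simp
  \<comment> \<open>An enumeration of the positive rationals, with 1 as a harmless positive value
    elsewhere. A rational lies strictly between \<open>max 0 (q 0)\<close> and \<open>a\<close>
    whenever \<open>0 < a\<close> and \<open>q 0 < a\<close>, so the rectangles \<open>B n\<close>
    cover \<open>?G\<close>.\<close>
  define b where "b n = (if 0 < (from_nat n :: rat) then of_rat (from_nat n) else 1 :: real)" for n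
  have b: "0 < b n" for n by (simp add: b_def)
  define B where "B n = {(a, q :: nat \<Rightarrow> real). b n < a \<and> q 0 \<le> b n}" for n
  have [measurable]: "B n \<in> sets (borel \<Otimes>\<^sub>M seq_space)" for n
  proof -
    have "{p \<in> space (borel \<Otimes>\<^sub>M seq_space). b n < fst p \<and> snd p 0 \<le> b n} \<in> sets (borel \<Otimes>\<^sub>M seq_space)"
      by measurable
    then show ?thesis by (simp add: B_def space_pair_measure space_PiM case_prod_unfold)
  qed
  have UN: "(\<Union>n. B n) = ?G"
  proof safe
    fix n a and q :: "nat \<Rightarrow> real" assume "(a, q) \<in> B n"
    then show "0 < a" "q 0 < a" using b[of n] by (auto simp: B_def)
  next
    fix a :: real and q :: "nat \<Rightarrow> real" assume "0 < a" "q 0 < a"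
    then obtain r where r: "max 0 (q 0) < of_rat r" "of_rat r < a"
      using of_rat_dense[of "max 0 (q 0)" a] by auto
    then have "b (to_nat r) = of_rat r" by (simp add: b_def)
    then have "(a, q) \<in> B (to_nat r)" using r by (simp add: B_def)
    then show "(a, q) \<in> (\<Union>n. B n)" by blast
  qed
  \<comment> \<open>The rectangles overlap and have to be made disjoint. The pieces are no longer
    rectangles, but the comparison inside \<open>B n\<close> holds for every measurable subset of
    it.\<close>
  have piece: "emeasure ?L (X \<inter> disjointed B n) = emeasure ?R (X \<inter> disjointed B n)" for n
  proof -
    have "range B \<subseteq> sets (borel \<Otimes>\<^sub>M seq_space)" by auto
    from sets.range_disjointed_sets[OF this] have [measurable]: "disjointed B n \<in> sets (borel \<Otimes>\<^sub>M seq_space)" by auto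
    have "X \<inter> disjointed B n = (X \<inter> disjointed B n) \<inter> B n"
      using disjointed_subset[of B n] by auto
    then show ?thesis
      using emeasure_head_tail_piece[OF b, of "X \<inter> disjointed B n" n] by (simp add: B_def)
  qed
  have "range B \<subseteq> sets (borel \<Otimes>\<^sub>M seq_space)" by auto
  from sets.range_disjointed_sets[OF this]
  have rD: "range (\<lambda>n. X \<inter> disjointed B n) \<subseteq> sets (borel \<Otimes>\<^sub>M seq_space)" by auto
  have dD: "disjoint_family (\<lambda>n. X \<inter> disjointed B n)"
    using disjoint_family_disjointed[of B] by (auto simp: disjoint_family_on_def)
  have UN': "(\<Union>n. X \<inter> disjointed B n) = X \<inter> ?G"
    using UN_disjointed_eq[of B] UN by auto
  have [measurable]: "?G \<in> sets (borel \<Otimes>\<^sub>M seq_space)" unfolding UN[symmetric] by measurable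
  \<comment> \<open>Almost surely the head is positive and exceeds the next jump, so
    \<open>?L\<close> is concentrated on \<open>?G\<close>.\<close>
  have "emeasure ?L X = emeasure ?L (X \<inter> ?G)"
  proof (rule emeasure_eq_AE)
    have "AE x in M. (\<Delta> 0 x, tail_jumps x) \<in> ?G"
      using AE_Delta by eventually_elim (auto simp: tail_jumps_def)
    then show "AE p in ?L. p \<in> X \<longleftrightarrow> p \<in> X \<inter> ?G"
      by (subst AE_distr_iff) auto
  qed auto
  also have "\<dots> = (\<Sum>n. emeasure ?L (X \<inter> disjointed B n))"
    unfolding UN'[symmetric] using rD dD by (intro suminf_emeasure[symmetric]) auto
  also have "\<dots> = (\<Sum>n. emeasure ?R (X \<inter> disjointed B n))" unfolding piece ..
  also have "\<dots> = emeasure ?R (X \<inter> ?G)"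
    unfolding UN'[symmetric] using rD dD by (intro suminf_emeasure) auto
  also have "\<dots> = emeasure (density ?R (indicator ?G)) X"
    by (subst emeasure_density_indicator) (auto simp: Int_commute)
  finally show "emeasure ?L X = emeasure (density ?R (indicator ?G)) X" .
qed

section \<open>The mean measure of the points and summability of the jumps\<close>

lemma nn_integral_cnt:
  assumes A[measurable]: "A \<in> sets borel" and fin: "emeasure \<Lambda> A < \<infinity>"
  shows "(\<integral>\<^sup>+ x. cnt A x \<partial>M) = emeasure \<Lambda> A"
proof -
  define c where "c = measure \<Lambda> A"
  define p where "p n = c ^ n / fact n * exp (- c)" for n
  have c: "0 \<le> c" by (simp add: c_def)
  have p: "0 \<le> p n" for n using c by (simp add: p_def)
  define E where "E n = {x \<in> space M. cnt A x = of_nat n}" for n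
  have [measurable]: "E n \<in> sets M" for n unfolding E_def by measurable
  have Ep: "prob (E n) = p n" for n
    using prob_cnt[OF A fin] by (simp add: E_def p_def c_def)
  \<comment> \<open>The Poisson weights sum to one, so the count is almost surely finite and the
    value infinity does not affect the mean.\<close>
  have "p sums (exp (- c) * exp c)"
  proof -
    have "(\<lambda>n. exp (- c) * (c ^ n /\<^sub>R fact n)) sums (exp (- c) * exp c)"
      by (intro sums_mult exp_converges)
    also have "(\<lambda>n. exp (- c) * (c ^ n /\<^sub>R fact n)) = p"
      by (simp add: p_def fun_eq_iff divide_inverse)
    finally show ?thesis .
  qed
  then have "p sums 1" by (simp add: exp_minus)
  moreover have "(\<lambda>n. prob (E n)) sums prob (\<Union>n. E n)"
    by (rule finite_measure_UNION) (auto simp: E_def disjoint_family_on_def)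
  ultimately have "prob (\<Union>n. E n) = 1" by (simp add: Ep sums_iff)
  then have ae: "AE x in M. x \<in> (\<Union>n. E n)" by (subst AE_in_set_eq_1) auto
  have "(\<integral>\<^sup>+ x. cnt A x \<partial>M) = (\<integral>\<^sup>+ x. (\<Sum>n. of_nat n * indicator (E n) x) \<partial>M)"
  proof (intro nn_integral_cong_AE, use ae in eventually_elim)
    fix x assume "x \<in> (\<Union>n. E n)"
    then obtain m where m: "x \<in> E m" by auto
    have "(\<Sum>n. of_nat n * indicator (E n) x :: ennreal) = (\<Sum>n\<in>{m}. of_nat n * indicator (E n) x)"
    proof (rule suminf_finite)
      fix n assume "n \<notin> {m}"
      then have "(of_nat n :: ennreal) \<noteq> of_nat m" by simp
      then have "x \<notin> E n" using m unfolding E_def by simp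
      then show "of_nat n * indicator (E n) x = (0 :: ennreal)" by simp
    qed simp
    also have "\<dots> = of_nat m" using m by simp
    also have "\<dots> = cnt A x" using m unfolding E_def by simp
    finally show "cnt A x = (\<Sum>n. of_nat n * indicator (E n) x)" by (rule sym)
  qed
  also have "\<dots> = (\<Sum>n. \<integral>\<^sup>+ x. of_nat n * indicator (E n) x \<partial>M)"
    by (intro nn_integral_suminf) auto
  also have "\<dots> = (\<Sum>n. ennreal (real n * p n))"
    by (simp add: nn_integral_cmult_indicator emeasure_eq_measure Ep ennreal_mult p
        ennreal_of_nat_eq_real_of_nat)
  also have "\<dots> = ennreal c"
    using poisson_mean_sums[of c, folded p_def] p by (intro suminf_ennreal_eq) auto
  also have "\<dots> = emeasure \<Lambda> A"
    using fin by (simp add: c_def emeasure_eq_ennreal_measure)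
  finally show ?thesis .
qed

text \<open>The mean measure \<open>\<nu>\<close> of the points is the image of counting measure
  times \<open>M\<close> under evaluation of the points. It agrees with the Levy measure on sets of
  finite intensity by the mean of a Poisson count, hence on all Borel sets by exhaustion.\<close>

lemma campbell:
  assumes [measurable]: "f \<in> borel_measurable borel"
  shows "(\<integral>\<^sup>+ x. (\<Sum>k. f (\<Delta> k x)) \<partial>M) = (\<integral>\<^sup>+ s. f s \<partial>\<Lambda>)"
proof -
  define \<nu> where "\<nu> = distr (count_space UNIV \<Otimes>\<^sub>M M) borel (\<lambda>(k, x). \<Delta> k x)"
  have [measurable]: "(\<lambda>(k, x). \<Delta> k x) \<in> borel_measurable (count_space UNIV \<Otimes>\<^sub>M M)"
    by (rule measurable_pair_measure_countable1) auto
  have \<nu>: "(\<integral>\<^sup>+ s. g s \<partial>\<nu>) = (\<integral>\<^sup>+ x. (\<Sum>k. g (\<Delta> k x)) \<partial>M)"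
    if [measurable]: "g \<in> borel_measurable borel" for g
  proof -
    have "(\<integral>\<^sup>+ s. g s \<partial>\<nu>) = (\<integral>\<^sup>+ p. g (case p of (k, x) \<Rightarrow> \<Delta> k x) \<partial>(count_space UNIV \<Otimes>\<^sub>M M))"
      unfolding \<nu>_def by (rule nn_integral_distr) auto
    also have "\<dots> = (\<integral>\<^sup>+ k. \<integral>\<^sup>+ x. g (\<Delta> k x) \<partial>M \<partial>count_space UNIV)"
      by (subst nn_integral_fst[symmetric]) auto
    also have "\<dots> = (\<integral>\<^sup>+ x. (\<Sum>k. g (\<Delta> k x)) \<partial>M)"
      by (simp add: nn_integral_count_space_nat nn_integral_suminf)
    finally show ?thesis .
  qed
  have "\<nu> = \<Lambda>"
  proof (rule measure_eqI)
    fix A assume "A \<in> sets \<nu>"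
    then have A[measurable]: "A \<in> sets borel" by (simp add: \<nu>_def)
    \<comment> \<open>These sets increase to \<open>A\<close> and have finite intensity. The
      nonpositive half-line is included so that their union is all of \<open>A\<close>; it is a null
      set of the Levy measure.\<close>
    define E where "E n = A \<inter> ({..0} \<union> {inverse (real (Suc n))<..})" for n
    have [measurable]: "E n \<in> sets borel" for n unfolding E_def by measurable
    have EA: "(\<Union>n. E n) = A"
    proof -
      have "\<exists>n. inverse (real (Suc n)) < x" if "0 < x" for x
        using reals_Archimedean[OF that] by auto
      then show ?thesis unfolding E_def by (auto simp: not_le) (metis not_le)
    qed
    have "incseq E"
    proof (rule incseq_SucI)
      fix n
      have "inverse (real (Suc (Suc n))) \<le> inverse (real (Suc n))"
        by (intro le_imp_inverse_le) auto
      then have "{inverse (real (Suc n))<..} \<subseteq> {inverse (real (Suc (Suc n)))<..}"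
        by (simp only: greaterThan_subset_iff)
      then show "E n \<subseteq> E (Suc n)" unfolding E_def by (intro Int_mono Un_mono order_refl)
    qed
    have "emeasure \<nu> (E n) = emeasure \<Lambda> (E n)" for n
    proof -
      have "emeasure \<Lambda> (E n) \<le> emeasure \<Lambda> ({..0} \<union> {inverse (real (Suc n))<..})"
        by (intro emeasure_mono) (auto simp: E_def)
      also have "\<dots> \<le> emeasure \<Lambda> {..0} + emeasure \<Lambda> {inverse (real (Suc n))<..}"
        by (intro emeasure_subadditive) auto
      also have "\<dots> < \<infinity>"
        using emeasure_levy_atMost_0[of "{..0}"] emeasure_levy_greaterThan[of "inverse (real (Suc n))"]
        by simp
      finally have fin: "emeasure \<Lambda> (E n) < \<infinity>" .
      have "emeasure \<nu> (E n) = (\<integral>\<^sup>+ s. indicator (E n) s \<partial>\<nu>)"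
        by (simp add: \<nu>_def)
      also have "\<dots> = (\<integral>\<^sup>+ x. cnt (E n) x \<partial>M)"
        by (subst \<nu>) (auto simp: point_count_eq_suminf intro!: nn_integral_cong)
      finally show ?thesis using nn_integral_cnt[OF _ fin] by simp
    qed
    then have "(SUP n. emeasure \<nu> (E n)) = (SUP n. emeasure \<Lambda> (E n))" by simp
    then show "emeasure \<nu> A = emeasure \<Lambda> A"
      using SUP_emeasure_incseq[of E \<nu>] SUP_emeasure_incseq[of E \<Lambda>] \<open>incseq E\<close>
      by (simp add: EA image_subset_iff \<nu>_def)
  qed (simp add: \<nu>_def)
  then show ?thesis using \<nu>[of f] by simp
qed

text \<open>The integrability condition on \<open>l\<close> controls only the truncated jumps, whose
  sum has finite mean. Convergence of that sum forces the truncated terms to 0, so from some index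
  on the truncation is inactive.\<close>

lemma AE_summable: "AE x in M. summable (\<lambda>k. \<Delta> k x)"
proof -
  have "(\<integral>\<^sup>+ x. (\<Sum>k. ennreal (min 1 (\<Delta> k x))) \<partial>M) < \<infinity>"
    using campbell[of "\<lambda>s. ennreal (min 1 s)"] nn_integral_levy_min by simp
  then have "AE x in M. (\<Sum>k. ennreal (min 1 (\<Delta> k x))) \<noteq> \<infinity>"
    by (intro nn_integral_PInf_AE) auto
  then show ?thesis
    using AE_Delta
  proof eventually_elim
    case (elim x)
    have nn: "0 \<le> min 1 (\<Delta> k x)" for k using elim(2) by (simp add: less_imp_le)
    have s: "summable (\<lambda>k. min 1 (\<Delta> k x))"
      by (rule summable_suminf_not_top) (use nn elim(1) in auto)
    then have "(\<lambda>k. min 1 (\<Delta> k x)) \<longlonglongrightarrow> 0" by (rule summable_LIMSEQ_zero)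
    then have "\<forall>\<^sub>F k in sequentially. min 1 (\<Delta> k x) < 1" by (rule order_tendstoD) simp
    then have "\<forall>\<^sub>F k in sequentially. min 1 (\<Delta> k x) = \<Delta> k x"
      by eventually_elim auto
    then show ?case using s by (simp add: summable_cong)
  qed
qed

end

subsection \<open>Random measures and conditional laws\<close>

lemma space_measure_algebra: "space (measure_algebra N) = {\<mu>. sets \<mu> = sets N}"
  unfolding measure_algebra_def space_Sup_eq_UN by (auto intro: exI[of _ "{}"])

lemma measurable_emeasure_measure_algebra [measurable]:
  assumes "A \<in> sets N"
  shows "(\<lambda>\<mu>. emeasure \<mu> A) \<in> borel_measurable (measure_algebra N)"
  unfolding measure_algebra_def
  by (rule measurable_Sup1[OF imageI[OF assms]])
    (auto intro!: measurable_vimage_algebra1)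

lemma measurable_measure_algebraI:
  assumes "\<And>x. x \<in> space M \<Longrightarrow> sets (f x) = sets N"
    and "\<And>A. A \<in> sets N \<Longrightarrow> (\<lambda>x. emeasure (f x) A) \<in> borel_measurable M"
  shows "f \<in> measurable M (measure_algebra N)"
  unfolding measure_algebra_def
proof (rule measurable_SUP2)
  show "sets N \<noteq> {}" by auto
  fix A assume "A \<in> sets N"
  then show "f \<in> measurable M (vimage_algebra {\<mu>. sets \<mu> = sets N} (\<lambda>\<mu>. emeasure \<mu> A) borel)"
    using assms by (intro measurable_vimage_algebra2) auto
qed auto

lemma measurable_total_mass [measurable]: "total_mass \<in> borel_measurable (measure_algebra N)"
proof -
  have "(\<lambda>\<mu>. enn2real (emeasure \<mu> (space N))) \<in> borel_measurable (measure_algebra N)"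
    by measurable
  moreover have "total_mass \<mu> = enn2real (emeasure \<mu> (space N))" if "\<mu> \<in> space (measure_algebra N)" for \<mu>
    using that sets_eq_imp_space_eq[of \<mu> N]
    by (simp add: space_measure_algebra total_mass_def measure_def)
  ultimately show ?thesis by (simp cong: measurable_cong)
qed

lemma measurable_normalize_measure [measurable]:
  "normalize_measure \<in> measurable (measure_algebra N) (measure_algebra N)"
proof (rule measurable_measure_algebraI)
  fix A assume [measurable]: "A \<in> sets N"
  have "(\<lambda>\<mu>. inverse (emeasure \<mu> (space N)) * emeasure \<mu> A) \<in> borel_measurable (measure_algebra N)"
    by measurable
  moreover have "emeasure (normalize_measure \<mu>) A = inverse (emeasure \<mu> (space N)) * emeasure \<mu> A"
    if "\<mu> \<in> space (measure_algebra N)" for \<mu>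
    using that sets_eq_imp_space_eq[of \<mu> N]
    by (simp add: space_measure_algebra normalize_measure_def)
  ultimately show "(\<lambda>\<mu>. emeasure (normalize_measure \<mu>) A) \<in> borel_measurable (measure_algebra N)"
    by (simp cong: measurable_cong)
qed (simp add: space_measure_algebra normalize_measure_def)

lemma measurable_atomic_measure [measurable]:
  "(\<lambda>(q, u). atomic_measure N q u) \<in>
     measurable (seq_space \<Otimes>\<^sub>M PiM UNIV (\<lambda>_. N)) (measure_algebra N)"
proof (rule measurable_measure_algebraI)
  fix A assume [measurable]: "A \<in> sets N"
  have "(\<lambda>p. \<Sum>k. ennreal (fst p k) * indicator A (snd p k)) \<in>
      borel_measurable (seq_space \<Otimes>\<^sub>M PiM UNIV (\<lambda>_. N))" by measurable
  then show "(\<lambda>p. emeasure (case p of (q, u) \<Rightarrow> atomic_measure N q u) A) \<in>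
      borel_measurable (seq_space \<Otimes>\<^sub>M PiM UNIV (\<lambda>_. N))"
    by (simp add: case_prod_unfold emeasure_atomic_measure)
qed auto

lemma emeasure_atomic_measure_space:
  assumes "\<And>k. 0 \<le> w k" "summable w" "\<And>k. u k \<in> space N"
  shows "emeasure (atomic_measure N w u) (space N) = ennreal (suminf w)"
  using assms by (simp add: emeasure_atomic_measure suminf_ennreal2)

lemma total_mass_atomic_measure:
  assumes "\<And>k. 0 \<le> w k" "summable w" "\<And>k. u k \<in> space N"
  shows "total_mass (atomic_measure N w u) = suminf w"
  using emeasure_atomic_measure_space[OF assms, simplified] assms suminf_nonneg[of w]
  by (simp add: total_mass_def measure_def)

lemma normalize_atomic_measure:
  assumes "\<And>k. 0 \<le> w k" "summable w" "\<And>k. u k \<in> space N" "0 < suminf w"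
  shows "normalize_measure (atomic_measure N w u) = atomic_measure N (\<lambda>k. w k / suminf w) u"
proof (rule measure_eqI)
  fix A assume "A \<in> sets (normalize_measure (atomic_measure N w u))"
  then have A: "A \<in> sets N" by (simp add: normalize_measure_def)
  have "emeasure (normalize_measure (atomic_measure N w u)) A =
      inverse (ennreal (suminf w)) * (\<Sum>k. ennreal (w k) * indicator A (u k))"
    using emeasure_atomic_measure_space[OF assms(1-3)] A
    by (simp add: normalize_measure_def emeasure_atomic_measure)
  also have "\<dots> = (\<Sum>k. inverse (ennreal (suminf w)) * (ennreal (w k) * indicator A (u k)))"
    by (rule ennreal_suminf_cmult[symmetric])
  also have "\<dots> = (\<Sum>k. ennreal (w k / suminf w) * indicator A (u k))"
    using assms by (simp add: inverse_ennreal divide_inverse ennreal_mult mult_ac)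
  finally show "emeasure (normalize_measure (atomic_measure N w u)) A =
      emeasure (atomic_measure N (\<lambda>k. w k / suminf w) u) A"
    using A by (simp add: emeasure_atomic_measure)
qed (simp add: normalize_measure_def)

section \<open>Disintegration and change of the conditioning law\<close>

lemma emeasure_joint_event:
  assumes [measurable]: "X \<in> measurable M N" "Y \<in> measurable M S" "A \<in> sets N" "B \<in> sets S"
  shows "emeasure M {x \<in> space M. X x \<in> A \<and> Y x \<in> B} =
    (\<integral>\<^sup>+ x. indicator A (X x) * indicator B (Y x) \<partial>M)"
proof -
  have "{x \<in> space M. X x \<in> A \<and> Y x \<in> B} \<in> sets M" by measurable
  then have "emeasure M {x \<in> space M. X x \<in> A \<and> Y x \<in> B} =
      (\<integral>\<^sup>+ x. indicator {x \<in> space M. X x \<in> A \<and> Y x \<in> B} x \<partial>M)" by simp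
  also have "\<dots> = (\<integral>\<^sup>+ x. indicator A (X x) * indicator B (Y x) \<partial>M)"
    by (intro nn_integral_cong) (auto simp: indicator_def)
  finally show ?thesis .
qed

lemma cond_law_kernel:
  assumes "cond_law M X N Y S K"
  shows "K \<in> measurable S (prob_algebra N)"
proof -
  have "sets (restrict_space S (space S)) = sets S"
    by (auto simp: sets_restrict_space)
  then show ?thesis
    using assms unfolding cond_law_on_def by (simp cong: measurable_cong_sets)
qed

text \<open>The defining identity covers rectangles only. Attaching \<open>y\<close> to the kernel,
  as \<open>k y\<close>, turns the joint law into a single mixture; rectangles identify it, and
  integration over a mixture then handles every jointly measurable \<open>f\<close>.\<close>

lemma nn_integral_cond_law:
  assumes M: "prob_space M" and K: "cond_law M X N Y S K"
    and f[measurable]: "f \<in> borel_measurable (N \<Otimes>\<^sub>M S)"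
  shows "(\<integral>\<^sup>+ x. f (X x, Y x) \<partial>M) = (\<integral>\<^sup>+ x. \<integral>\<^sup>+ z. f (z, Y x) \<partial>K (Y x) \<partial>M)"
proof -
  interpret prob_space M by fact
  have [measurable]: "X \<in> measurable M N" "Y \<in> measurable M S"
    using K by (auto simp: cond_law_on_def)
  note Kp[measurable] = cond_law_kernel[OF K]
  define k where "k y = distr (K y) (N \<Otimes>\<^sub>M S) (\<lambda>z. (z, y))" for y
  have k[measurable]: "k \<in> measurable S (prob_algebra (N \<Otimes>\<^sub>M S))"
    unfolding k_def[abs_def] by measurable
  define \<mu> where "\<mu> = distr M (N \<Otimes>\<^sub>M S) (\<lambda>x. (X x, Y x))"
  define \<nu> where "\<nu> = distr M S Y \<bind> k"
  have ne: "space (distr M S Y) \<noteq> {}"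
    using not_empty measurable_space[of Y M S] by auto
  have ks: "k \<in> measurable (distr M S Y) (subprob_algebra (N \<Otimes>\<^sub>M S))"
    using measurable_prob_algebraD[OF k] by simp
  have sets\<nu>: "sets \<nu> = sets (N \<Otimes>\<^sub>M S)"
    unfolding \<nu>_def by (rule sets_bind[OF sets_kernel[OF ks]]) (use ne in auto)
  have Ky: "prob_space (K y)" "sets (K y) = sets N" if "y \<in> space S" for y
    using measurable_space[OF Kp that] by (auto simp: space_prob_algebra)
  have "\<mu> = \<nu>"
  proof (rule measure_eqI_generator_eq[OF Int_stable_pair_measure_generator[of N S]])
    show "{a \<times> b |a b. a \<in> sets N \<and> b \<in> sets S} \<subseteq> Pow (space N \<times> space S)"
      using sets.space_closed[of N] sets.space_closed[of S] by auto
    show "sets \<mu> = sigma_sets (space N \<times> space S) {a \<times> b |a b. a \<in> sets N \<and> b \<in> sets S}"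
      unfolding \<mu>_def sets_distr sets_pair_measure ..
    show "sets \<nu> = sigma_sets (space N \<times> space S) {a \<times> b |a b. a \<in> sets N \<and> b \<in> sets S}"
      unfolding sets\<nu> sets_pair_measure ..
    show "range (\<lambda>_::nat. space N \<times> space S) \<subseteq> {a \<times> b |a b. a \<in> sets N \<and> b \<in> sets S}" by auto
    show "emeasure \<mu> (space N \<times> space S) \<noteq> \<infinity>"
      unfolding \<mu>_def by (subst emeasure_distr) auto
    fix Z assume "Z \<in> {a \<times> b |a b. a \<in> sets N \<and> b \<in> sets S}"
    then obtain A B where Z: "Z = A \<times> B" and [measurable]: "A \<in> sets N" "B \<in> sets S" by auto
    have "emeasure \<mu> Z = emeasure M {x \<in> space M. X x \<in> A \<and> Y x \<in> B}"
      unfolding \<mu>_def Z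
      by (subst emeasure_distr) (auto intro!: arg_cong[where f="emeasure M"])
    also have "\<dots> = (\<integral>\<^sup>+ x. emeasure (K (Y x)) A * indicator B (Y x) \<partial>M)"
      using K sets.sets_into_space[of B S] by (auto simp: cond_law_on_def)
    also have "\<dots> = (\<integral>\<^sup>+ x. emeasure (k (Y x)) Z \<partial>M)"
    proof (rule nn_integral_cong)
      fix x assume "x \<in> space M"
      then have y: "Y x \<in> space S" by (rule measurable_space[rotated]) simp
      have m: "(\<lambda>z. (z, Y x)) \<in> measurable (K (Y x)) (N \<Otimes>\<^sub>M S)"
        using y by (simp add: measurable_cong_sets[OF Ky(2)[OF y] refl])
      have "emeasure (k (Y x)) Z = emeasure (K (Y x)) ((\<lambda>z. (z, Y x)) -` (A \<times> B) \<inter> space (K (Y x)))"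
        unfolding k_def Z by (rule emeasure_distr[OF m]) simp
      also have "(\<lambda>z. (z, Y x)) -` (A \<times> B) \<inter> space (K (Y x)) = (if Y x \<in> B then A else {})"
        using sets.sets_into_space[of A N] sets_eq_imp_space_eq[OF Ky(2)[OF y]] by auto
      finally show "emeasure (K (Y x)) A * indicator B (Y x) = emeasure (k (Y x)) Z" by auto
    qed
    also have "\<dots> = (\<integral>\<^sup>+ y. emeasure (k y) Z \<partial>distr M S Y)"
      using measurable_prob_algebraD[OF k] unfolding Z
      by (subst nn_integral_distr) (auto intro!: measurable_emeasure_kernel)
    also have "\<dots> = emeasure \<nu> Z"
      unfolding \<nu>_def by (rule emeasure_bind[OF ne ks, symmetric]) (simp add: Z)
    finally show "emeasure \<mu> Z = emeasure \<nu> Z" .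
  qed auto
  have "(\<integral>\<^sup>+ x. f (X x, Y x) \<partial>M) = (\<integral>\<^sup>+ p. f p \<partial>\<mu>)"
    unfolding \<mu>_def by (subst nn_integral_distr) auto
  also have "\<dots> = (\<integral>\<^sup>+ y. \<integral>\<^sup>+ p. f p \<partial>k y \<partial>distr M S Y)"
    unfolding \<open>\<mu> = \<nu>\<close> \<nu>_def by (rule nn_integral_bind[OF f ks])
  also have "\<dots> = (\<integral>\<^sup>+ x. \<integral>\<^sup>+ p. f p \<partial>k (Y x) \<partial>M)"
    using measurable_prob_algebraD[OF k]
    by (subst nn_integral_distr) (auto intro!: nn_integral_measurable_subprob_algebra2[where N="N \<Otimes>\<^sub>M S"])
  also have "\<dots> = (\<integral>\<^sup>+ x. \<integral>\<^sup>+ z. f (z, Y x) \<partial>K (Y x) \<partial>M)"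
  proof (rule nn_integral_cong)
    fix x assume "x \<in> space M"
    then have y: "Y x \<in> space S" by (rule measurable_space[rotated]) simp
    have m: "(\<lambda>z. (z, Y x)) \<in> measurable (K (Y x)) (N \<Otimes>\<^sub>M S)"
      using y by (simp add: measurable_cong_sets[OF Ky(2)[OF y] refl])
    show "(\<integral>\<^sup>+ p. f p \<partial>k (Y x)) = (\<integral>\<^sup>+ z. f (z, Y x) \<partial>K (Y x))"
      unfolding k_def by (rule nn_integral_distr[OF m]) simp
  qed
  finally show ?thesis .
qed

text \<open>Sharing the kernel means that the two joint laws differ only through their second
  marginals, so the density \<open>\<phi>\<close> of the marginals is also the density of the joint
  laws.\<close>

lemma nn_integral_tilt:
  assumes M: "prob_space M" "prob_space M'"
    and K: "cond_law M X N Y S K" "cond_law M' X' N Y' S K"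
    and tilt: "distr M' S Y' = density (distr M S Y) \<phi>" and [measurable]: "\<phi> \<in> borel_measurable S"
    and g[measurable]: "g \<in> borel_measurable (N \<Otimes>\<^sub>M S)"
  shows "(\<integral>\<^sup>+ x. g (X' x, Y' x) \<partial>M') = (\<integral>\<^sup>+ x. \<phi> (Y x) * g (X x, Y x) \<partial>M)"
proof -
  have [measurable]: "X \<in> measurable M N" "Y \<in> measurable M S" "Y' \<in> measurable M' S"
    using K by (auto simp: cond_law_on_def)
  note [measurable] = measurable_prob_algebraD[OF cond_law_kernel[OF K(1)]]
  have [measurable]: "(\<lambda>y. \<integral>\<^sup>+ z. g (z, y) \<partial>K y) \<in> borel_measurable S"
    by (rule nn_integral_measurable_subprob_algebra2[where N=N]) measurable
  have "(\<integral>\<^sup>+ x. g (X' x, Y' x) \<partial>M') = (\<integral>\<^sup>+ x. \<integral>\<^sup>+ z. g (z, Y' x) \<partial>K (Y' x) \<partial>M')"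
    by (rule nn_integral_cond_law[OF M(2) K(2) g])
  also have "\<dots> = (\<integral>\<^sup>+ y. \<integral>\<^sup>+ z. g (z, y) \<partial>K y \<partial>distr M' S Y')"
    by (subst nn_integral_distr) auto
  also have "\<dots> = (\<integral>\<^sup>+ y. \<phi> y * (\<integral>\<^sup>+ z. g (z, y) \<partial>K y) \<partial>distr M S Y)"
    unfolding tilt by (subst nn_integral_density) auto
  also have "\<dots> = (\<integral>\<^sup>+ x. \<phi> (Y x) * (\<integral>\<^sup>+ z. g (z, Y x) \<partial>K (Y x)) \<partial>M)"
    by (subst nn_integral_distr) auto
  also have "\<dots> = (\<integral>\<^sup>+ x. \<integral>\<^sup>+ z. \<phi> (Y x) * g (z, Y x) \<partial>K (Y x) \<partial>M)"
  proof (rule nn_integral_cong)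
    fix x assume "x \<in> space M"
    then have y: "Y x \<in> space S" by (rule measurable_space[rotated]) simp
    have "sets (K (Y x)) = sets N"
      using measurable_space[OF cond_law_kernel[OF K(1)] y] by (simp add: space_prob_algebra)
    then have "(\<lambda>z. g (z, Y x)) \<in> borel_measurable (K (Y x))"
      using y by (simp cong: measurable_cong_sets)
    then show "\<phi> (Y x) * (\<integral>\<^sup>+ z. g (z, Y x) \<partial>K (Y x)) = (\<integral>\<^sup>+ z. \<phi> (Y x) * g (z, Y x) \<partial>K (Y x))"
      by (rule nn_integral_cmult[symmetric])
  qed
  also have "\<dots> = (\<integral>\<^sup>+ x. \<phi> (Y x) * g (X x, Y x) \<partial>M)"
    using nn_integral_cond_law[OF M(1) K(1), of "\<lambda>(z, y). \<phi> y * g (z, y)"] by simp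
  finally show ?thesis .
qed

section \<open>Normalized weights of the remaining jumps\<close>

definition normalize_seq :: "(nat \<Rightarrow> real) \<Rightarrow> nat \<Rightarrow> real" where
  "normalize_seq q = (\<lambda>k. q k / suminf q)"

lemma measurable_suminf_seq [measurable]: "suminf \<in> borel_measurable seq_space"
proof -
  have "(\<lambda>q. \<Sum>k. q k) \<in> borel_measurable seq_space" by measurable
  then show ?thesis by simp
qed

lemma measurable_normalize_seq [measurable]: "normalize_seq \<in> measurable seq_space seq_space"
  unfolding normalize_seq_def[abs_def] by (intro measurable_PiM_single') auto

context ranked_poisson
begin

text \<open>Normalization is invariant under scaling, so the division by \<open>\<Delta> 0\<close>
  cancels in the normalized weights and survives only in the total mass.\<close>

lemma AE_gd_measure:
  assumes "\<And>k x. x \<in> space M \<Longrightarrow> U k x \<in> space N"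
  shows "AE x in M. 0 < \<Delta> 0 x \<and> 0 < suminf (tail_jumps x) \<and>
    total_mass (gd_measure N \<Delta> U x) = suminf (tail_jumps x) / \<Delta> 0 x \<and>
    (\<lambda>k. gd_weights \<Delta> x k / total_mass (gd_measure N \<Delta> U x)) = normalize_seq (tail_jumps x) \<and>
    normalize_measure (gd_measure N \<Delta> U x) =
      atomic_measure N (normalize_seq (tail_jumps x)) (\<lambda>k. U k x)"
  using AE_Delta AE_summable AE_space
proof eventually_elim
  case (elim x)
  have pos: "0 < \<Delta> k x" for k using elim(1) by simp
  have "summable (tail_jumps x)"
    using elim(2) unfolding tail_jumps_def by (subst summable_Suc_iff)
  then have s: "summable (tail_jumps x)" "0 < suminf (tail_jumps x)"
    using pos by (auto simp: tail_jumps_def intro!: suminf_pos)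
  have w: "gd_weights \<Delta> x = (\<lambda>k. tail_jumps x k / \<Delta> 0 x)"
    by (simp add: gd_weights_def tail_jumps_def)
  have w1: "0 \<le> gd_weights \<Delta> x k" for k
    using pos[of 0] pos[of "Suc k"] by (simp add: gd_weights_def)
  have w2: "summable (gd_weights \<Delta> x)" "suminf (gd_weights \<Delta> x) = suminf (tail_jumps x) / \<Delta> 0 x"
    unfolding w using s by (auto intro: summable_divide simp: suminf_divide)
  have u: "U k x \<in> space N" for k using assms elim(3) .
  have nrm: "(\<lambda>k. gd_weights \<Delta> x k / (suminf (tail_jumps x) / \<Delta> 0 x)) = normalize_seq (tail_jumps x)"
    using pos[of 0] by (simp add: w normalize_seq_def)
  have tm: "total_mass (gd_measure N \<Delta> U x) = suminf (tail_jumps x) / \<Delta> 0 x"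
    unfolding gd_measure_def using total_mass_atomic_measure[OF w1 w2(1) u] w2(2) by simp
  have "normalize_measure (gd_measure N \<Delta> U x) =
      atomic_measure N (normalize_seq (tail_jumps x)) (\<lambda>k. U k x)"
    using normalize_atomic_measure[OF w1 w2(1), of "\<lambda>k. U k x" N, OF u] pos[of 0] s(2)
    unfolding gd_measure_def w2(2) nrm by simp
  then show ?case using pos[of 0] s(2) tm nrm by simp
qed

text \<open>If the remaining points sum to at most \<open>a\<close>, they automatically lie below \<open>a\<close>; so the
  constraint in the Mecke equation disappears, and with it the dependence on \<open>a\<close>.\<close>

lemma nn_integral_head_tail:
  assumes f[measurable]: "f \<in> borel_measurable (borel \<Otimes>\<^sub>M seq_space)"
    and "\<And>a q. a < suminf q \<Longrightarrow> f (a, q) = 0"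
  shows "(\<integral>\<^sup>+ x. f (\<Delta> 0 x, tail_jumps x) \<partial>M) =
    (\<integral>\<^sup>+ a. \<integral>\<^sup>+ x. f (a, jumps x) * indicator {0<..} a \<partial>M \<partial>\<Lambda>)"
proof -
  interpret J: prob_space law_jumps by (rule prob_space_law_jumps)
  let ?G = "{(a, q :: nat \<Rightarrow> real). 0 < a \<and> q 0 < a}"
  have "{p \<in> space (borel \<Otimes>\<^sub>M seq_space). 0 < fst p \<and> snd p 0 < fst p} \<in> sets (borel \<Otimes>\<^sub>M seq_space)"
    by measurable
  then have G[measurable]: "?G \<in> sets (borel \<Otimes>\<^sub>M seq_space)"
    by (simp add: space_pair_measure space_PiM case_prod_unfold)
  have "(\<integral>\<^sup>+ x. f (\<Delta> 0 x, tail_jumps x) \<partial>M) =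
      (\<integral>\<^sup>+ p. f p \<partial>distr M (borel \<Otimes>\<^sub>M seq_space) (\<lambda>x. (\<Delta> 0 x, tail_jumps x)))"
    by (subst nn_integral_distr) auto
  also have "\<dots> = (\<integral>\<^sup>+ p. indicator ?G p * f p \<partial>(\<Lambda> \<Otimes>\<^sub>M law_jumps))"
    unfolding distr_head_tail by (rule nn_integral_density) measurable
  also have "\<dots> = (\<integral>\<^sup>+ a. \<integral>\<^sup>+ q. indicator ?G (a, q) * f (a, q) \<partial>law_jumps \<partial>\<Lambda>)"
    by (rule J.nn_integral_fst[symmetric]) measurable
  also have "\<dots> = (\<integral>\<^sup>+ a. \<integral>\<^sup>+ x. indicator ?G (a, jumps x) * f (a, jumps x) \<partial>M \<partial>\<Lambda>)"
    by (intro nn_integral_cong nn_integral_distr) measurable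
  also have "\<dots> = (\<integral>\<^sup>+ a. \<integral>\<^sup>+ x. f (a, jumps x) * indicator {0<..} a \<partial>M \<partial>\<Lambda>)"
  proof (rule nn_integral_cong)
    fix a
    have "AE x in M. indicator ?G (a, jumps x) * f (a, jumps x) = f (a, jumps x) * indicator {0<..} a"
      using AE_Delta AE_summable
    proof eventually_elim
      case (elim x)
      \<comment> \<open>The inequality is strict because all later jumps are positive. Hence a sum
        of at most \<open>a\<close> puts the first jump strictly below \<open>a\<close>, as
        \<open>?G\<close> demands.\<close>
      have "sum (jumps x) {..<1} < suminf (jumps x)"
        by (rule sum_less_suminf) (use elim in \<open>auto simp: jumps_def\<close>)
      then have "jumps x 0 < a" if "\<not> a < suminf (jumps x)" using that by simp
      then show ?case
        using assms(2)[of a "jumps x"] by (cases "a < suminf (jumps x)") (auto simp: indicator_def)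
    qed
    then show "(\<integral>\<^sup>+ x. indicator ?G (a, jumps x) * f (a, jumps x) \<partial>M) =
        (\<integral>\<^sup>+ x. f (a, jumps x) * indicator {0<..} a \<partial>M)"
      by (rule nn_integral_cong_AE)
  qed
  finally show ?thesis .
qed

end

theorem theorem4p1:
  fixes M :: "'a measure" and M' :: "'b measure" and N :: "'u measure"
    and l :: "real \<Rightarrow> real"
    and \<Delta> :: "nat \<Rightarrow> 'a \<Rightarrow> real" and U :: "nat \<Rightarrow> 'a \<Rightarrow> 'u"
    and \<xi> :: "'a \<Rightarrow> 'u measure"
    and \<omega> :: "real \<Rightarrow> real \<Rightarrow> real"
    and D\<^sub>o T\<^sub>o :: "'b \<Rightarrow> real" and \<eta> :: "'b \<Rightarrow> 'u measure"
    and W :: "'b \<Rightarrow> nat \<Rightarrow> real"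
    and K :: "real \<times> real \<Rightarrow> ((nat \<Rightarrow> real) \<times> 'u measure) measure"
    and PK :: "real \<Rightarrow> (nat \<Rightarrow> real) measure" and P\<^sub>o :: "real \<Rightarrow> real measure"
    and Q :: "'b \<Rightarrow> nat \<Rightarrow> real"
  assumes "prob_space M"
    and "infinite_levy_density l"
    and "ranked_poisson_points M l \<Delta>"
    \<comment> \<open>i.i.d. locations, independent of the jumps\<close>
    and "prob_space.indep_vars M (\<lambda>_. N) U UNIV"
    and "\<And>k. distr M N (U k) = distr M N (U 0)"
    and "prob_space.indep_set M
           {(\<lambda>x k. \<Delta> k x) -` A \<inter> space M | A. A \<in> sets seq_space}
           {(\<lambda>x k. U k x) -` B \<inter> space M | B. B \<in> sets (PiM UNIV (\<lambda>_. N))}"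
    and "\<And>x. \<xi> x = gd_measure N \<Delta> U x"
    \<comment> \<open>the tilted pair\<close>
    and "(\<lambda>(a, t). \<omega> a t) \<in> borel_measurable (borel \<Otimes>\<^sub>M borel)"
    and "\<And>a t. 0 < a \<Longrightarrow> 0 < t \<Longrightarrow> 0 \<le> \<omega> a t"
    and "(\<integral>\<^sup>+ x. ennreal (\<omega> (\<Delta> 0 x) (total_mass (\<xi> x))) \<partial>M) = 1"
    and "prob_space M'"
    and "D\<^sub>o \<in> borel_measurable M'" and "T\<^sub>o \<in> borel_measurable M'"
    and "distr M' (borel \<Otimes>\<^sub>M borel) (\<lambda>x. (D\<^sub>o x, T\<^sub>o x)) =
           density (distr M (borel \<Otimes>\<^sub>M borel) (\<lambda>x. (\<Delta> 0 x, total_mass (\<xi> x))))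
             (\<lambda>(a, t). ennreal (\<omega> a t))"
    \<comment> \<open>given the tilted pair, \<open>\<eta>\<close> has the conditional law of \<open>\<xi>\<close>, jointly with the ranked weights
        (no diffuseness of the law of \<open>U\<close> is assumed, so atoms of the series may share a location
        and the weights are carried along with the measure)\<close>
    and "cond_law M (\<lambda>x. (gd_weights \<Delta> x, \<xi> x)) (seq_space \<Otimes>\<^sub>M measure_algebra N)
           (\<lambda>x. (\<Delta> 0 x, total_mass (\<xi> x))) (borel \<Otimes>\<^sub>M borel) K"
    and "cond_law M' (\<lambda>x. (W x, \<eta> x)) (seq_space \<Otimes>\<^sub>M measure_algebra N)
           (\<lambda>x. (D\<^sub>o x, T\<^sub>o x)) (borel \<Otimes>\<^sub>M borel) K"
    \<comment> \<open>the ranked weights of the normalization of \<open>\<eta>\<close>\<close>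
    and "\<And>x k. Q x k = W x k / total_mass (\<eta> x)"
    \<comment> \<open>arbitrary versions of \<open>PK(\<lambda>|t)\<close> and of \<open>P\<^sub>o t\<close>\<close>
    and "pk_kernel M \<Delta> PK"
    and "cond_law M' (\<lambda>x. D\<^sub>o x * T\<^sub>o x) borel T\<^sub>o borel P\<^sub>o"
  shows "cond_law_on {0<..1} M' (\<lambda>x. normalize_measure (\<eta> x)) (measure_algebra N) T\<^sub>o borel
           (\<lambda>t. random_weights_law N (distr M N (U 0)) (pk_mixture PK (P\<^sub>o t))) \<and>
         cond_law_on {0<..1} M' Q seq_space T\<^sub>o borel (\<lambda>t. pk_mixture PK (P\<^sub>o t)) \<and>
         cond_law_on ({0<..1} \<times> {0<..}) M' Q seq_space
           (\<lambda>x. (T\<^sub>o x, D\<^sub>o x)) (borel \<Otimes>\<^sub>M borel) (\<lambda>(t, a). PK (a * t))"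
proof -
  interpret M: prob_space M by fact
  interpret ranked_poisson M l \<Delta>
    using assms(2,3) by unfold_locales
  note \<xi> = assms(7) and indep_U = assms(4) and ident_U = assms(5) and indep_JU = assms(6)
    and \<omega> = assms(8) and tilt = assms(14) and K = assms(15) and K' = assms(16) and Q = assms(17)
  note PK = assms(18)[unfolded pk_kernel_def] and P\<^sub>o = assms(19)
  let ?MA = "measure_algebra N" and ?B2 = "borel \<Otimes>\<^sub>M borel :: (real \<times> real) measure"
  have [measurable]: "D\<^sub>o \<in> borel_measurable M'" "T\<^sub>o \<in> borel_measurable M'" by fact+
  have "(\<lambda>x. (W x, \<eta> x)) \<in> measurable M' (seq_space \<Otimes>\<^sub>M ?MA)"
    "(\<lambda>x. (gd_weights \<Delta> x, \<xi> x)) \<in> measurable M (seq_space \<Otimes>\<^sub>M ?MA)"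
    using K K' by (auto simp: cond_law_on_def)
  from this[THEN measurable_compose[OF _ measurable_fst]] this[THEN measurable_compose[OF _ measurable_snd]]
  have [measurable]: "W \<in> measurable M' seq_space" "\<eta> \<in> measurable M' ?MA"
    "gd_weights \<Delta> \<in> measurable M seq_space" "\<xi> \<in> measurable M ?MA" by simp_all
  have Q_meas[measurable]: "Q \<in> measurable M' seq_space"
  proof -
    have "(\<lambda>x k. W x k / total_mass (\<eta> x)) \<in> measurable M' seq_space"
      by (intro measurable_PiM_single') auto
    moreover have "Q = (\<lambda>x k. W x k / total_mass (\<eta> x))" using Q by (simp add: fun_eq_iff)
    ultimately show ?thesis by simp
  qed
  have U[measurable]: "U k \<in> measurable M N" for k
    using indep_U by (auto simp: M.indep_vars_def)
  note PK_meas[measurable] = cond_law_kernel[OF PK] and P\<^sub>o_meas[measurable] = cond_law_kernel[OF P\<^sub>o]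
  note PK_sub[measurable] = measurable_prob_algebraD[OF PK_meas]
    and P\<^sub>o_sub[measurable] = measurable_prob_algebraD[OF P\<^sub>o_meas]
  define \<phi> where "\<phi> p = (case p of (a, t) \<Rightarrow> ennreal (\<omega> a t))" for p
  have \<phi>[measurable]: "\<phi> \<in> borel_measurable ?B2"
    unfolding \<phi>_def using measurable_compose[OF \<omega> measurable_ennreal] by (simp add: case_prod_unfold)
  define S where "S x = suminf (tail_jumps x)" for x
  have [measurable]: "S \<in> borel_measurable M" unfolding S_def by measurable
  have ae: "AE x in M. 0 < \<Delta> 0 x \<and> 0 < S x \<and> total_mass (\<xi> x) = S x / \<Delta> 0 x \<and>
      (\<lambda>k. gd_weights \<Delta> x k / total_mass (\<xi> x)) = normalize_seq (tail_jumps x) \<and>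
      normalize_measure (\<xi> x) = atomic_measure N (normalize_seq (tail_jumps x)) (\<lambda>k. U k x)"
    unfolding \<xi> S_def using measurable_space[OF U] by (intro AE_gd_measure) auto

  \<comment> \<open>Both pairs have the same kernel \<open>K\<close>, so moving from
    \<open>M'\<close> to \<open>M\<close> costs exactly the density \<open>\<phi>\<close> of the
    conditioning variables.\<close>
  have transfer: "(\<integral>\<^sup>+ x. g ((W x, \<eta> x), (D\<^sub>o x, T\<^sub>o x)) \<partial>M') =
      (\<integral>\<^sup>+ x. \<phi> (\<Delta> 0 x, total_mass (\<xi> x)) * g ((gd_weights \<Delta> x, \<xi> x), (\<Delta> 0 x, total_mass (\<xi> x))) \<partial>M)"
    if "g \<in> borel_measurable ((seq_space \<Otimes>\<^sub>M ?MA) \<Otimes>\<^sub>M ?B2)" for g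
    using nn_integral_tilt[OF assms(1,11) K K' _ \<phi> that] tilt by (simp add: \<phi>_def[abs_def])
  \<comment> \<open>For functions of the weights the random measure disappears altogether: on
    \<open>M\<close> everything is expressed by the head and the remaining jumps.\<close>
  have transfer_Q: "(\<integral>\<^sup>+ x. h (Q x, (D\<^sub>o x, T\<^sub>o x)) \<partial>M') =
      (\<integral>\<^sup>+ x. \<phi> (\<Delta> 0 x, S x / \<Delta> 0 x) * h (normalize_seq (tail_jumps x), (\<Delta> 0 x, S x / \<Delta> 0 x)) \<partial>M)"
    if [measurable]: "h \<in> borel_measurable (seq_space \<Otimes>\<^sub>M ?B2)" for h
  proof -
    have [measurable]: "(\<lambda>p k. fst p k / total_mass (snd p)) \<in> measurable (seq_space \<Otimes>\<^sub>M ?MA) seq_space"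
      by (intro measurable_PiM_single') auto
    have "(\<integral>\<^sup>+ x. h (Q x, (D\<^sub>o x, T\<^sub>o x)) \<partial>M') =
        (\<integral>\<^sup>+ x. h (\<lambda>k. W x k / total_mass (\<eta> x), (D\<^sub>o x, T\<^sub>o x)) \<partial>M')"
      by (simp add: Q[symmetric])
    also have "\<dots> = (\<integral>\<^sup>+ x. \<phi> (\<Delta> 0 x, total_mass (\<xi> x)) *
        h (\<lambda>k. gd_weights \<Delta> x k / total_mass (\<xi> x), (\<Delta> 0 x, total_mass (\<xi> x))) \<partial>M)"
      using transfer[of "\<lambda>p. h ((\<lambda>p k. fst p k / total_mass (snd p)) (fst p), snd p)"] by simp
    also have "\<dots> = (\<integral>\<^sup>+ x. \<phi> (\<Delta> 0 x, S x / \<Delta> 0 x) *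
        h (normalize_seq (tail_jumps x), (\<Delta> 0 x, S x / \<Delta> 0 x)) \<partial>M)"
    proof (intro nn_integral_cong_AE, use ae in eventually_elim)
      fix x
      assume "0 < \<Delta> 0 x \<and> 0 < S x \<and> total_mass (\<xi> x) = S x / \<Delta> 0 x \<and>
        (\<lambda>k. gd_weights \<Delta> x k / total_mass (\<xi> x)) = normalize_seq (tail_jumps x) \<and>
        normalize_measure (\<xi> x) = atomic_measure N (normalize_seq (tail_jumps x)) (\<lambda>k. U k x)"
      then have t: "total_mass (\<xi> x) = S x / \<Delta> 0 x"
        and n: "(\<lambda>k. gd_weights \<Delta> x k / total_mass (\<xi> x)) = normalize_seq (tail_jumps x)" by blast+
      show "\<phi> (\<Delta> 0 x, total_mass (\<xi> x)) *
          h (\<lambda>k. gd_weights \<Delta> x k / total_mass (\<xi> x), (\<Delta> 0 x, total_mass (\<xi> x))) =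
        \<phi> (\<Delta> 0 x, S x / \<Delta> 0 x) * h (normalize_seq (tail_jumps x), (\<Delta> 0 x, S x / \<Delta> 0 x))"
        unfolding n unfolding t ..
    qed
    finally show ?thesis .
  qed

  \<comment> \<open>The condition that the mass is at most 1 becomes
    \<open>S x \<le> \<Delta> 0 x\<close>, which is what \<open>nn_integral_head_tail\<close> needs.
    On the right the head is integrated against the Levy measure and the remaining jumps have become
    a full, unconstrained configuration.\<close>
  have key: "(\<integral>\<^sup>+ x. f (Q x) * \<psi> (D\<^sub>o x, T\<^sub>o x) * indicator {..1} (T\<^sub>o x) \<partial>M') =
      (\<integral>\<^sup>+ a. \<integral>\<^sup>+ x. \<phi> (a, suminf (jumps x) / a) * f (normalize_seq (jumps x)) *
        \<psi> (a, suminf (jumps x) / a) * indicator {..a} (suminf (jumps x)) * indicator {0<..} a \<partial>M \<partial>\<Lambda>)"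
    if [measurable]: "f \<in> borel_measurable seq_space" "\<psi> \<in> borel_measurable ?B2" for f \<psi>
  proof -
    define G where "G p = \<phi> (fst p, suminf (snd p) / fst p) * f (normalize_seq (snd p)) *
        \<psi> (fst p, suminf (snd p) / fst p) * indicator {..fst p} (suminf (snd p))" for p
    have [measurable]: "G \<in> borel_measurable (borel \<Otimes>\<^sub>M seq_space)"
      unfolding G_def[abs_def] indicator_def atMost_iff by measurable
    have "(\<integral>\<^sup>+ x. f (Q x) * \<psi> (D\<^sub>o x, T\<^sub>o x) * indicator {..1} (T\<^sub>o x) \<partial>M') =
        (\<integral>\<^sup>+ x. \<phi> (\<Delta> 0 x, S x / \<Delta> 0 x) * (f (normalize_seq (tail_jumps x)) *
          \<psi> (\<Delta> 0 x, S x / \<Delta> 0 x) * indicator {..1} (S x / \<Delta> 0 x)) \<partial>M)"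
      using transfer_Q[of "\<lambda>p. f (fst p) * \<psi> (snd p) * indicator {..1} (snd (snd p))"] by simp
    also have "\<dots> = (\<integral>\<^sup>+ x. G (\<Delta> 0 x, tail_jumps x) \<partial>M)"
    proof (intro nn_integral_cong_AE, use ae in eventually_elim)
      fix x
      assume "0 < \<Delta> 0 x \<and> 0 < S x \<and> total_mass (\<xi> x) = S x / \<Delta> 0 x \<and>
        (\<lambda>k. gd_weights \<Delta> x k / total_mass (\<xi> x)) = normalize_seq (tail_jumps x) \<and>
        normalize_measure (\<xi> x) = atomic_measure N (normalize_seq (tail_jumps x)) (\<lambda>k. U k x)"
      then have "0 < \<Delta> 0 x" by blast
      then have "indicator {..1} (S x / \<Delta> 0 x) = (indicator {..\<Delta> 0 x} (S x) :: ennreal)"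
        by (simp add: indicator_def)
      then show "\<phi> (\<Delta> 0 x, S x / \<Delta> 0 x) * (f (normalize_seq (tail_jumps x)) *
          \<psi> (\<Delta> 0 x, S x / \<Delta> 0 x) * indicator {..1} (S x / \<Delta> 0 x)) = G (\<Delta> 0 x, tail_jumps x)"
        by (simp add: G_def mult_ac flip: S_def)
    qed
    also have "\<dots> = (\<integral>\<^sup>+ a. \<integral>\<^sup>+ x. G (a, jumps x) * indicator {0<..} a \<partial>M \<partial>\<Lambda>)"
    proof (rule nn_integral_head_tail)
      show "G (a, q) = 0" if "a < suminf q" for a q using that by (simp add: G_def)
    qed measurable
    finally show ?thesis by (simp add: G_def)
  qed

  \<comment> \<open>\<open>key\<close> is used in both directions. In between, for each fixed
    \<open>a\<close>, the full configuration is disintegrated along its sum, which is where the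
    definition of \<open>PK\<close> enters.\<close>
  have PK_law: "(\<integral>\<^sup>+ x. f (Q x) * \<psi> (D\<^sub>o x, T\<^sub>o x) * indicator {..1} (T\<^sub>o x) \<partial>M') =
      (\<integral>\<^sup>+ x. (\<integral>\<^sup>+ q. f q \<partial>PK (D\<^sub>o x * T\<^sub>o x)) * \<psi> (D\<^sub>o x, T\<^sub>o x) * indicator {..1} (T\<^sub>o x) \<partial>M')"
    if [measurable]: "f \<in> borel_measurable seq_space" "\<psi> \<in> borel_measurable ?B2" for f \<psi>
  proof -
    have [measurable]: "(\<lambda>t. \<integral>\<^sup>+ q. f q \<partial>PK t) \<in> borel_measurable borel"
      by (rule nn_integral_measurable_subprob_algebra2[where N=seq_space]) measurable
    have PK': "cond_law M (\<lambda>x. normalize_seq (jumps x)) seq_space (\<lambda>x. suminf (jumps x)) borel PK"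
      using PK by (simp add: normalize_seq_def jumps_def)
    have "(\<integral>\<^sup>+ x. f (Q x) * \<psi> (D\<^sub>o x, T\<^sub>o x) * indicator {..1} (T\<^sub>o x) \<partial>M') =
      (\<integral>\<^sup>+ a. \<integral>\<^sup>+ x. \<phi> (a, suminf (jumps x) / a) * f (normalize_seq (jumps x)) *
        \<psi> (a, suminf (jumps x) / a) * indicator {..a} (suminf (jumps x)) * indicator {0<..} a \<partial>M \<partial>\<Lambda>)"
      by (rule key) measurable
    \<comment> \<open>The argument of \<open>PK\<close> is left as \<open>a * (s / a)\<close>, with
      \<open>s\<close> the sum of the jumps, and the factor 1 is kept, so that the expression has
      the shape of \<open>key\<close> with the constant test function 1: head \<open>a\<close> and
      mass \<open>s / a\<close> multiply to the parameter \<open>s\<close>.\<close>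
    also have "\<dots> = (\<integral>\<^sup>+ a. \<integral>\<^sup>+ x. \<phi> (a, suminf (jumps x) / a) * 1 *
        ((\<integral>\<^sup>+ q. f q \<partial>PK (a * (suminf (jumps x) / a))) * \<psi> (a, suminf (jumps x) / a)) *
        indicator {..a} (suminf (jumps x)) * indicator {0<..} a \<partial>M \<partial>\<Lambda>)"
    proof (rule nn_integral_cong)
      fix a :: real
      \<comment> \<open>For fixed \<open>a\<close> the tilt, the test function and the cutoff depend
        on the configuration through its sum only, so they are constants for the kernel at that
        sum.\<close>
      let ?\<theta> = "\<lambda>t. \<phi> (a, t / a) * \<psi> (a, t / a) * indicator {..a} t * indicator {0<..} a"
      have "(\<integral>\<^sup>+ x. f (normalize_seq (jumps x)) * ?\<theta> (suminf (jumps x)) \<partial>M) =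
          (\<integral>\<^sup>+ x. \<integral>\<^sup>+ q. f q * ?\<theta> (suminf (jumps x)) \<partial>PK (suminf (jumps x)) \<partial>M)"
        using nn_integral_cond_law[OF assms(1) PK', of "\<lambda>p. f (fst p) * ?\<theta> (snd p)"] by simp
      also have "\<dots> = (\<integral>\<^sup>+ x. (\<integral>\<^sup>+ q. f q \<partial>PK (suminf (jumps x))) * ?\<theta> (suminf (jumps x)) \<partial>M)"
      proof (intro nn_integral_cong nn_integral_multc)
        fix x
        have "sets (PK (suminf (jumps x))) = sets seq_space"
          using measurable_space[OF PK_meas, of "suminf (jumps x)"] by (simp add: space_prob_algebra)
        then show "f \<in> borel_measurable (PK (suminf (jumps x)))"
          by (simp cong: measurable_cong_sets)
      qed
      also have "\<dots> = (\<integral>\<^sup>+ x. \<phi> (a, suminf (jumps x) / a) * 1 *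
        ((\<integral>\<^sup>+ q. f q \<partial>PK (a * (suminf (jumps x) / a))) * \<psi> (a, suminf (jumps x) / a)) *
        indicator {..a} (suminf (jumps x)) * indicator {0<..} a \<partial>M)"
        by (intro nn_integral_cong) (auto simp: indicator_def mult_ac)
      finally show "(\<integral>\<^sup>+ x. \<phi> (a, suminf (jumps x) / a) * f (normalize_seq (jumps x)) *
        \<psi> (a, suminf (jumps x) / a) * indicator {..a} (suminf (jumps x)) * indicator {0<..} a \<partial>M) =
        (\<integral>\<^sup>+ x. \<phi> (a, suminf (jumps x) / a) * 1 *
        ((\<integral>\<^sup>+ q. f q \<partial>PK (a * (suminf (jumps x) / a))) * \<psi> (a, suminf (jumps x) / a)) *
        indicator {..a} (suminf (jumps x)) * indicator {0<..} a \<partial>M)"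
        by (simp add: mult_ac)
    qed
    \<comment> \<open>\<open>key\<close> read from right to left: the kernel integral is a function
      of head and mass and is absorbed into the test function of these two.\<close>
    also have "\<dots> = (\<integral>\<^sup>+ x. (\<integral>\<^sup>+ q. f q \<partial>PK (D\<^sub>o x * T\<^sub>o x)) * \<psi> (D\<^sub>o x, T\<^sub>o x) * indicator {..1} (T\<^sub>o x) \<partial>M')"
      using key[of "\<lambda>_. 1" "\<lambda>p. (\<integral>\<^sup>+ q. f q \<partial>PK (fst p * snd p)) * \<psi> p"] by simp
    finally show ?thesis .
  qed

  have mix_meas: "(\<lambda>t. pk_mixture PK (P\<^sub>o t)) \<in> measurable borel (prob_algebra seq_space)"
    unfolding pk_mixture_def by (rule measurable_bind_prob_space[OF P\<^sub>o_meas PK_meas])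
  \<comment> \<open>With a test function of the mass alone, the head enters only through the product
    of head and mass. Its conditional law given the mass averages the kernels \<open>PK\<close>, and
    this average is the mixture.\<close>
  have mix_law: "(\<integral>\<^sup>+ x. f (Q x) * indicator B (T\<^sub>o x) \<partial>M') =
      (\<integral>\<^sup>+ x. (\<integral>\<^sup>+ q. f q \<partial>pk_mixture PK (P\<^sub>o (T\<^sub>o x))) * indicator B (T\<^sub>o x) \<partial>M')"
    if [measurable]: "f \<in> borel_measurable seq_space" "B \<in> sets borel" and B: "B \<subseteq> {0<..1}" for f B
  proof -
    have [measurable]: "(\<lambda>t. \<integral>\<^sup>+ q. f q \<partial>PK t) \<in> borel_measurable borel"
      by (rule nn_integral_measurable_subprob_algebra2[where N=seq_space]) measurable
    have ind: "indicator B t * indicator {..1} t = (indicator B t :: ennreal)" for t :: real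
      using B by (auto simp: indicator_def)
    have "(\<integral>\<^sup>+ x. f (Q x) * indicator B (T\<^sub>o x) \<partial>M') =
        (\<integral>\<^sup>+ x. (\<integral>\<^sup>+ q. f q \<partial>PK (D\<^sub>o x * T\<^sub>o x)) * indicator B (T\<^sub>o x) \<partial>M')"
      using PK_law[of f "\<lambda>p. indicator B (snd p)"] by (simp add: ind mult.assoc)
    also have "\<dots> = (\<integral>\<^sup>+ x. \<integral>\<^sup>+ z. (\<integral>\<^sup>+ q. f q \<partial>PK z) * indicator B (T\<^sub>o x) \<partial>P\<^sub>o (T\<^sub>o x) \<partial>M')"
      using nn_integral_cond_law[OF assms(11) P\<^sub>o, of "\<lambda>p. (\<integral>\<^sup>+ q. f q \<partial>PK (fst p)) * indicator B (snd p)"]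
      by simp
    also have "\<dots> = (\<integral>\<^sup>+ x. (\<integral>\<^sup>+ q. f q \<partial>pk_mixture PK (P\<^sub>o (T\<^sub>o x))) * indicator B (T\<^sub>o x) \<partial>M')"
    proof (rule nn_integral_cong)
      fix x
      have sP: "sets (P\<^sub>o (T\<^sub>o x)) = sets borel"
        using measurable_space[OF P\<^sub>o_meas, of "T\<^sub>o x"] by (simp add: space_prob_algebra)
      have "(\<integral>\<^sup>+ q. f q \<partial>pk_mixture PK (P\<^sub>o (T\<^sub>o x))) = (\<integral>\<^sup>+ z. \<integral>\<^sup>+ q. f q \<partial>PK z \<partial>P\<^sub>o (T\<^sub>o x))"
        unfolding pk_mixture_def
        by (rule nn_integral_bind[where B=seq_space]) (use PK_sub sP in \<open>auto cong: measurable_cong_sets\<close>)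
      then show "(\<integral>\<^sup>+ z. (\<integral>\<^sup>+ q. f q \<partial>PK z) * indicator B (T\<^sub>o x) \<partial>P\<^sub>o (T\<^sub>o x)) =
          (\<integral>\<^sup>+ q. f q \<partial>pk_mixture PK (P\<^sub>o (T\<^sub>o x))) * indicator B (T\<^sub>o x)"
        using sP by (subst nn_integral_multc) (auto cong: measurable_cong_sets)
    qed
    finally show ?thesis .
  qed

  define \<nu> where "\<nu> = distr M N (U 0)"
  define Us where "Us x = (\<lambda>k. U k x)" for x
  have prob_\<nu>: "prob_space \<nu>" unfolding \<nu>_def by (rule M.prob_space_distr) measurable
  let ?P\<nu> = "PiM UNIV (\<lambda>_::nat. \<nu>)"
  have prob_P\<nu>: "prob_space ?P\<nu>" by (rule prob_space_PiM) (rule prob_\<nu>)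
  interpret P\<nu>: prob_space ?P\<nu> by (rule prob_P\<nu>)
  have sets_P\<nu>[measurable_cong]: "sets ?P\<nu> = sets (PiM UNIV (\<lambda>_. N))"
    by (intro sets_PiM_cong) (auto simp: \<nu>_def)
  have Us[measurable]: "Us \<in> measurable M (PiM UNIV (\<lambda>_. N))"
    unfolding Us_def[abs_def] using measurable_space[OF U] by (intro measurable_PiM_single') auto
  have law_Us: "distr M (PiM UNIV (\<lambda>_. N)) Us = ?P\<nu>"
  proof -
    have "distr M (PiM UNIV (\<lambda>_. N)) (\<lambda>x. \<lambda>k\<in>UNIV. U k x) = PiM UNIV (\<lambda>k. distr M N (U k))"
      using M.indep_vars_iff_distr_eq_PiM'[of UNIV U "\<lambda>_. N"] indep_U U by blast
    also have "(\<lambda>k. distr M N (U k)) = (\<lambda>_. \<nu>)" unfolding \<nu>_def by (intro ext ident_U)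
    finally show ?thesis by (simp add: Us_def[abs_def])
  qed
  \<comment> \<open>Independence of jumps and locations as a product law, so that the locations can
    be integrated out by Fubini.\<close>
  have law_JU: "law_jumps \<Otimes>\<^sub>M ?P\<nu> = distr M (seq_space \<Otimes>\<^sub>M PiM UNIV (\<lambda>_. N)) (\<lambda>x. (jumps x, Us x))"
  proof (rule pair_measure_eqI)
    show "sigma_finite_measure law_jumps"
      using prob_space_law_jumps by (simp add: prob_space_def finite_measure_def)
    show "sigma_finite_measure ?P\<nu>" by (rule P\<nu>.sigma_finite_measure_axioms)
    show "sets (law_jumps \<Otimes>\<^sub>M ?P\<nu>) = sets (distr M (seq_space \<Otimes>\<^sub>M PiM UNIV (\<lambda>_. N)) (\<lambda>x. (jumps x, Us x)))"
      unfolding sets_distr by (intro sets_pair_measure_cong) (simp_all add: sets_P\<nu>)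
    fix A B assume "A \<in> sets law_jumps" "B \<in> sets ?P\<nu>"
    then have [measurable]: "A \<in> sets seq_space" "B \<in> sets (PiM UNIV (\<lambda>_. N))" by (auto simp: sets_P\<nu>)
    have "M.prob ((jumps -` A \<inter> space M) \<inter> (Us -` B \<inter> space M)) =
        M.prob (jumps -` A \<inter> space M) * M.prob (Us -` B \<inter> space M)"
      unfolding jumps_def[abs_def] Us_def[abs_def]
      by (rule M.indep_setD[OF indep_JU]) auto
    then have "emeasure M ((jumps -` A \<inter> space M) \<inter> (Us -` B \<inter> space M)) =
        emeasure M (jumps -` A \<inter> space M) * emeasure M (Us -` B \<inter> space M)"
      by (simp add: M.emeasure_eq_measure ennreal_mult)
    moreover have "(jumps -` A \<inter> space M) \<inter> (Us -` B \<inter> space M) =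
        (\<lambda>x. (jumps x, Us x)) -` (A \<times> B) \<inter> space M" by auto
    ultimately show "emeasure law_jumps A * emeasure ?P\<nu> B =
        emeasure (distr M (seq_space \<Otimes>\<^sub>M PiM UNIV (\<lambda>_. N)) (\<lambda>x. (jumps x, Us x))) (A \<times> B)"
      unfolding law_Us[symmetric] by (simp add: emeasure_distr)
  qed
  \<comment> \<open>The probability that fixed weights \<open>q\<close> with fresh i.i.d. locations
    give a measure in \<open>A\<close>.\<close>
  define \<kappa> where "\<kappa> A q = (\<integral>\<^sup>+ u. indicator A (atomic_measure N q u) \<partial>?P\<nu>)" for A q
  have [measurable]: "(\<lambda>p. atomic_measure N (fst p) (snd p)) \<in> measurable (seq_space \<Otimes>\<^sub>M ?P\<nu>) ?MA"
    using measurable_atomic_measure[of N] by (simp add: case_prod_unfold cong: measurable_cong_sets)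
  have \<kappa>[measurable]: "\<kappa> A \<in> borel_measurable seq_space" if [measurable]: "A \<in> sets ?MA" for A
    unfolding \<kappa>_def[abs_def]
    using P\<nu>.borel_measurable_nn_integral_fst[of "\<lambda>p. indicator A (atomic_measure N (fst p) (snd p))" seq_space]
    by simp

  \<comment> \<open>On \<open>M\<close> the locations are independent of all jumps, head included,
    and hence of the tilt and of the mass as well. Integrating them out leaves
    \<open>\<kappa> A\<close> of the normalized weights, a function of the weights that
    \<open>transfer_Q\<close> carries back to \<open>M'\<close>.\<close>
  have normalized: "(\<integral>\<^sup>+ x. indicator A (normalize_measure (\<eta> x)) * indicator B (T\<^sub>o x) \<partial>M') =
      (\<integral>\<^sup>+ x. \<kappa> A (Q x) * indicator B (T\<^sub>o x) \<partial>M')"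
    if [measurable]: "A \<in> sets ?MA" "B \<in> sets borel" for A B
  proof -
    define tl where "tl q = (\<lambda>k. q (Suc k))" for q :: "nat \<Rightarrow> real"
    have [measurable]: "tl \<in> measurable seq_space seq_space"
      unfolding tl_def[abs_def] by (intro measurable_PiM_single') auto
    define \<tau> where "\<tau> q = suminf (tl q) / q 0" for q :: "nat \<Rightarrow> real"
    have [measurable]: "\<tau> \<in> borel_measurable seq_space" unfolding \<tau>_def[abs_def] by measurable
    \<comment> \<open>The tilt and the event for the mass as one function of the jumps alone, so
      that it leaves the integral over the locations.\<close>
    define \<theta> where "\<theta> q = \<phi> (q 0, \<tau> q) * indicator B (\<tau> q)" for q
    have [measurable]: "\<theta> \<in> borel_measurable seq_space" unfolding \<theta>_def[abs_def] by measurable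
    have tl: "tl (jumps x) = tail_jumps x" for x by (simp add: tl_def jumps_def tail_jumps_def)
    have \<tau>: "\<tau> (jumps x) = S x / \<Delta> 0 x" for x unfolding \<tau>_def tl S_def by (simp add: jumps_def)
    have \<theta>: "\<theta> (jumps x) = \<phi> (\<Delta> 0 x, S x / \<Delta> 0 x) * indicator B (S x / \<Delta> 0 x)" for x
      unfolding \<theta>_def \<tau> by (simp add: jumps_def)
    have "(\<integral>\<^sup>+ x. indicator A (normalize_measure (\<eta> x)) * indicator B (T\<^sub>o x) \<partial>M') =
        (\<integral>\<^sup>+ x. \<phi> (\<Delta> 0 x, total_mass (\<xi> x)) *
          (indicator A (normalize_measure (\<xi> x)) * indicator B (total_mass (\<xi> x))) \<partial>M)"
      using transfer[of "\<lambda>p. indicator A (normalize_measure (snd (fst p))) * indicator B (snd (snd p))"]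
      by simp
    also have "\<dots> = (\<integral>\<^sup>+ x. \<theta> (jumps x) * indicator A (atomic_measure N (normalize_seq (tl (jumps x))) (Us x)) \<partial>M)"
    proof (intro nn_integral_cong_AE, use ae in eventually_elim)
      fix x
      assume "0 < \<Delta> 0 x \<and> 0 < S x \<and> total_mass (\<xi> x) = S x / \<Delta> 0 x \<and>
        (\<lambda>k. gd_weights \<Delta> x k / total_mass (\<xi> x)) = normalize_seq (tail_jumps x) \<and>
        normalize_measure (\<xi> x) = atomic_measure N (normalize_seq (tail_jumps x)) (\<lambda>k. U k x)"
      then have t: "total_mass (\<xi> x) = S x / \<Delta> 0 x"
        and n: "normalize_measure (\<xi> x) = atomic_measure N (normalize_seq (tail_jumps x)) (\<lambda>k. U k x)" by blast+
      show "\<phi> (\<Delta> 0 x, total_mass (\<xi> x)) *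
          (indicator A (normalize_measure (\<xi> x)) * indicator B (total_mass (\<xi> x))) =
        \<theta> (jumps x) * indicator A (atomic_measure N (normalize_seq (tl (jumps x))) (Us x))"
        unfolding n t \<theta> tl Us_def by (simp add: mult_ac)
    qed
    also have "\<dots> = (\<integral>\<^sup>+ p. \<theta> (fst p) * indicator A (atomic_measure N (normalize_seq (tl (fst p))) (snd p))
        \<partial>distr M (seq_space \<Otimes>\<^sub>M PiM UNIV (\<lambda>_. N)) (\<lambda>x. (jumps x, Us x)))"
      using measurable_compose[OF _ measurable_atomic_measure[of N],
          of "\<lambda>p. (normalize_seq (tl (fst p)), snd p)" "seq_space \<Otimes>\<^sub>M PiM UNIV (\<lambda>_. N)"]
      by (subst nn_integral_distr) auto
    also have "\<dots> = (\<integral>\<^sup>+ q. \<integral>\<^sup>+ u. \<theta> q * indicator A (atomic_measure N (normalize_seq (tl q)) u) \<partial>?P\<nu> \<partial>law_jumps)"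
      unfolding law_JU[symmetric]
      using measurable_compose[OF _ measurable_atomic_measure[of N],
          of "\<lambda>p. (normalize_seq (tl (fst p)), snd p)" "law_jumps \<Otimes>\<^sub>M ?P\<nu>"]
      by (subst P\<nu>.nn_integral_fst[symmetric]) auto
    also have "\<dots> = (\<integral>\<^sup>+ q. \<theta> q * \<kappa> A (normalize_seq (tl q)) \<partial>law_jumps)"
    proof (rule nn_integral_cong)
      fix q
      have "(\<lambda>u. indicator A (atomic_measure N (normalize_seq (tl q)) u) :: ennreal) \<in>
          borel_measurable ?P\<nu>"
      proof -
        have "(\<lambda>u. (normalize_seq (tl q), u)) \<in> measurable ?P\<nu> (seq_space \<Otimes>\<^sub>M PiM UNIV (\<lambda>_. N))"
          by (intro measurable_Pair measurable_const measurable_ident_sets sets_P\<nu>) (simp add: space_PiM)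
        from measurable_compose[OF measurable_compose[OF this measurable_atomic_measure]
            borel_measurable_indicator[OF \<open>A \<in> sets ?MA\<close>]]
        show ?thesis by simp
      qed
      then show "(\<integral>\<^sup>+ u. \<theta> q * indicator A (atomic_measure N (normalize_seq (tl q)) u) \<partial>?P\<nu>) =
          \<theta> q * \<kappa> A (normalize_seq (tl q))"
        unfolding \<kappa>_def by (rule nn_integral_cmult)
    qed
    also have "\<dots> = (\<integral>\<^sup>+ x. \<theta> (jumps x) * \<kappa> A (normalize_seq (tail_jumps x)) \<partial>M)"
      by (subst nn_integral_distr) (auto simp: tl)
    also have "\<dots> = (\<integral>\<^sup>+ x. \<kappa> A (Q x) * indicator B (T\<^sub>o x) \<partial>M')"
      using transfer_Q[of "\<lambda>p. \<kappa> A (fst p) * indicator B (snd (snd p))"]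
      by (simp add: \<theta> mult_ac)
    finally show ?thesis .
  qed

  have rwl: "emeasure (random_weights_law N \<nu> \<rho>) A = (\<integral>\<^sup>+ q. \<kappa> A q \<partial>\<rho>)"
    if [measurable_cong]: "sets \<rho> = sets seq_space" and [measurable]: "A \<in> sets ?MA" for \<rho> A
  proof -
    have m: "(\<lambda>(q, u). atomic_measure N q u) \<in> measurable (\<rho> \<Otimes>\<^sub>M ?P\<nu>) ?MA"
      using measurable_atomic_measure[of N] by (simp cong: measurable_cong_sets)
    have "emeasure (random_weights_law N \<nu> \<rho>) A =
        (\<integral>\<^sup>+ p. indicator A p \<partial>distr (\<rho> \<Otimes>\<^sub>M ?P\<nu>) ?MA (\<lambda>(q, u). atomic_measure N q u))"
      unfolding random_weights_law_def by simp
    also have "\<dots> = (\<integral>\<^sup>+ p. indicator A (case p of (q, u) \<Rightarrow> atomic_measure N q u) \<partial>(\<rho> \<Otimes>\<^sub>M ?P\<nu>))"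
      by (rule nn_integral_distr[OF m]) simp
    also have "\<dots> = (\<integral>\<^sup>+ q. \<kappa> A q \<partial>\<rho>)"
      unfolding \<kappa>_def using m by (subst P\<nu>.nn_integral_fst[symmetric]) auto
    finally show ?thesis .
  qed
  have sets_mix: "sets (pk_mixture PK (P\<^sub>o t)) = sets seq_space" for t
    using measurable_space[OF mix_meas, of t] by (simp add: space_prob_algebra)

  have "cond_law_on {0<..1} M' (\<lambda>x. normalize_measure (\<eta> x)) ?MA T\<^sub>o borel
      (\<lambda>t. random_weights_law N \<nu> (pk_mixture PK (P\<^sub>o t)))"
    unfolding cond_law_on_def
  proof (intro conjI ballI impI)
    have "(\<lambda>t. pk_mixture PK (P\<^sub>o t) \<Otimes>\<^sub>M ?P\<nu>) \<in> measurable borel (prob_algebra (seq_space \<Otimes>\<^sub>M PiM UNIV (\<lambda>_. N)))"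
      using prob_P\<nu> sets_P\<nu> by (intro measurable_pair_prob mix_meas measurable_const) (simp add: space_prob_algebra)
    then have "(\<lambda>t. random_weights_law N \<nu> (pk_mixture PK (P\<^sub>o t))) \<in> measurable borel (prob_algebra ?MA)"
      unfolding random_weights_law_def
      by (rule measurable_compose) (rule measurable_distr_prob_space[OF measurable_atomic_measure])
    then show "(\<lambda>t. random_weights_law N \<nu> (pk_mixture PK (P\<^sub>o t))) \<in>
        measurable (restrict_space borel {0<..1}) (prob_algebra ?MA)"
      by (rule measurable_restrict_space1)
    fix A and B :: "real set" assume [measurable]: "A \<in> sets ?MA" "B \<in> sets borel" and B: "B \<subseteq> {0<..1}"
    have "emeasure M' {x \<in> space M'. normalize_measure (\<eta> x) \<in> A \<and> T\<^sub>o x \<in> B} =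
        (\<integral>\<^sup>+ x. indicator A (normalize_measure (\<eta> x)) * indicator B (T\<^sub>o x) \<partial>M')"
      by (rule emeasure_joint_event) measurable
    also have "\<dots> = (\<integral>\<^sup>+ x. \<kappa> A (Q x) * indicator B (T\<^sub>o x) \<partial>M')" by (rule normalized) measurable
    \<comment> \<open>\<open>\<kappa> A\<close> serves as one more test function of the ranked
      weights; the law of the random measure thus reduces to that of its weights.\<close>
    also have "\<dots> = (\<integral>\<^sup>+ x. (\<integral>\<^sup>+ q. \<kappa> A q \<partial>pk_mixture PK (P\<^sub>o (T\<^sub>o x))) * indicator B (T\<^sub>o x) \<partial>M')"
      using B by (intro mix_law) measurable
    finally show "emeasure M' {x \<in> space M'. normalize_measure (\<eta> x) \<in> A \<and> T\<^sub>o x \<in> B} =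
        (\<integral>\<^sup>+ x. emeasure (random_weights_law N \<nu> (pk_mixture PK (P\<^sub>o (T\<^sub>o x)))) A * indicator B (T\<^sub>o x) \<partial>M')"
      by (simp add: rwl sets_mix)
  qed measurable
  moreover have "cond_law_on {0<..1} M' Q seq_space T\<^sub>o borel (\<lambda>t. pk_mixture PK (P\<^sub>o t))"
    unfolding cond_law_on_def
  proof (intro conjI ballI impI)
    show "(\<lambda>t. pk_mixture PK (P\<^sub>o t)) \<in> measurable (restrict_space borel {0<..1}) (prob_algebra seq_space)"
      by (rule measurable_restrict_space1[OF mix_meas])
    fix A and B :: "real set" assume [measurable]: "A \<in> sets seq_space" "B \<in> sets borel" and B: "B \<subseteq> {0<..1}"
    have "emeasure M' {x \<in> space M'. Q x \<in> A \<and> T\<^sub>o x \<in> B} =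
        (\<integral>\<^sup>+ x. indicator A (Q x) * indicator B (T\<^sub>o x) \<partial>M')"
      by (rule emeasure_joint_event) measurable
    also have "\<dots> = (\<integral>\<^sup>+ x. (\<integral>\<^sup>+ q. indicator A q \<partial>pk_mixture PK (P\<^sub>o (T\<^sub>o x))) * indicator B (T\<^sub>o x) \<partial>M')"
      using B by (intro mix_law) measurable
    finally show "emeasure M' {x \<in> space M'. Q x \<in> A \<and> T\<^sub>o x \<in> B} =
        (\<integral>\<^sup>+ x. emeasure (pk_mixture PK (P\<^sub>o (T\<^sub>o x))) A * indicator B (T\<^sub>o x) \<partial>M')"
      by (simp add: sets_mix)
  qed measurable
  moreover have "cond_law_on ({0<..1} \<times> {0<..}) M' Q seq_space
      (\<lambda>x. (T\<^sub>o x, D\<^sub>o x)) (borel \<Otimes>\<^sub>M borel) (\<lambda>(t, a). PK (a * t))"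
    unfolding cond_law_on_def
  proof (intro conjI ballI impI)
    have "(\<lambda>p. PK (snd p * fst p)) \<in> measurable ?B2 (prob_algebra seq_space)" by measurable
    then show "(\<lambda>(t, a). PK (a * t)) \<in>
        measurable (restrict_space ?B2 ({0<..1} \<times> {0<..})) (prob_algebra seq_space)"
      by (simp add: case_prod_unfold measurable_restrict_space1)
    fix A and B :: "(real \<times> real) set"
    assume [measurable]: "A \<in> sets seq_space" "B \<in> sets ?B2" and B: "B \<subseteq> {0<..1} \<times> {0<..}"
    \<comment> \<open>\<open>PK_law\<close> carries a cutoff of the mass at 1; as \<open>B\<close>
      lies where the mass is at most 1, the cutoff is absorbed.\<close>
    have ind: "indicator B (t, a) * indicator {..1} t = (indicator B (t, a) :: ennreal)" for t a :: real
      using B by (auto simp: indicator_def)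
    have sPK: "sets (PK t) = sets seq_space" for t
      using measurable_space[OF PK_meas, of t] by (simp add: space_prob_algebra)
    have "emeasure M' {x \<in> space M'. Q x \<in> A \<and> (T\<^sub>o x, D\<^sub>o x) \<in> B} =
        (\<integral>\<^sup>+ x. indicator A (Q x) * indicator B (T\<^sub>o x, D\<^sub>o x) \<partial>M')"
      by (rule emeasure_joint_event) measurable
    also have "\<dots> = (\<integral>\<^sup>+ x. (\<integral>\<^sup>+ q. indicator A q \<partial>PK (D\<^sub>o x * T\<^sub>o x)) * indicator B (T\<^sub>o x, D\<^sub>o x) \<partial>M')"
      using PK_law[of "indicator A" "\<lambda>p. indicator B (snd p, fst p)"] by (simp add: ind mult.assoc)
    finally show "emeasure M' {x \<in> space M'. Q x \<in> A \<and> (T\<^sub>o x, D\<^sub>o x) \<in> B} =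
        (\<integral>\<^sup>+ x. emeasure (case (T\<^sub>o x, D\<^sub>o x) of (t, a) \<Rightarrow> PK (a * t)) A * indicator B (T\<^sub>o x, D\<^sub>o x) \<partial>M')"
      by (simp add: sPK)
  qed measurable
  ultimately show ?thesis by (simp add: \<nu>_def)
qed

end
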